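(* For each positive integer $d$, let $P_s(d)$ be the probability that a $d\times d$ matrix chosen uniformly at random from $\{0,1\}^{d\times d}$ is singular (over $\mathbb{R}$). Let $\mathcal{G}$ be the set of all linearly independent sets of $d-1$ vectors in $\{0,1\}^d\subset\mathbb{R}^d$, for a set $S$ of vectors let $v(S)$ be the number of vectors of $\{0,1\}^d$ in the linear span of $S$, and let \[E(d)=\frac{1}{|\mathcal{G}|}\sum_{G\in\mathcal{G}} v(G).\] Then, as $d\to\infty$, \[P_s(d)=\left(\frac{1}{2^d}E(d)+\frac{d^2}{2^{d+1}}\right)(1+o(1)).\]
   Context: $E(d)$ is the expected number of $0/1$-vectors in the hyperplane (through the origin) spanned by a uniformly random linearly independent $(d-1)$-set of $0/1$-vectors of length $d$. The notation $f(d)=g(d)(1+o(1))$ means $f(d)/g(d)\to 1$ as $d\to\infty$. *)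

theory Defs
  imports "HOL-Probability.Probability_Mass_Function" "Jordan_Normal_Form.VS_Connect"
begin

definition zero_one_vecs :: "nat \<Rightarrow> real vec set" where
  "zero_one_vecs d = {v \<in> carrier_vec d. \<forall>i<d. v $ i \<in> {0, 1}}"

definition zero_one_mats :: "nat \<Rightarrow> real mat set" where
  "zero_one_mats d = {A \<in> carrier_mat d d. \<forall>i<d. \<forall>j<d. A $$ (i, j) \<in> {0, 1}}"

definition singular_mat :: "real mat \<Rightarrow> bool" where
  "singular_mat A \<longleftrightarrow> \<not> invertible_mat A"

definition P_s :: "nat \<Rightarrow> real" where
  "P_s d = measure_pmf.prob (pmf_of_set (zero_one_mats d)) {A. singular_mat A}"

abbreviation real_span :: "nat \<Rightarrow> real vec set \<Rightarrow> real vec set" where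
  "real_span d \<equiv> LinearCombinations.module.span class_ring (module_vec TYPE(real) d)"

abbreviation real_lin_indpt :: "nat \<Rightarrow> real vec set \<Rightarrow> bool" where
  "real_lin_indpt d S \<equiv> \<not> LinearCombinations.module.lin_dep class_ring (module_vec TYPE(real) d) S"

definition lin_indpt_sets :: "nat \<Rightarrow> real vec set set" where
  "lin_indpt_sets d = {S. S \<subseteq> zero_one_vecs d \<and> card S = d - 1 \<and> real_lin_indpt d S}"

definition num_spanned :: "nat \<Rightarrow> real vec set \<Rightarrow> nat" where
  "num_spanned d S = card (zero_one_vecs d \<inter> real_span d S)"

definition expected_spanned :: "nat \<Rightarrow> real" where
  "expected_spanned d = (1 / real (card (lin_indpt_sets d))) * (\<Sum>G\<in>lin_indpt_sets d. real (num_spanned d G))"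

end

theory Submission
  imports Defs "HOL-Real_Asymp.Real_Asymp"
begin

text \<open>
  Let \<open>p\<close> be the probability that the first \<open>d - 1\<close> columns are dependent, so that
  \<open>P_s d = p + (1 - p) * E(d) / 2 ^ d\<close>. The claim follows once \<open>p\<close> is \<open>d\<^sup>2 / 2 ^ (d + 1)\<close> up to a
  factor \<open>1 + o(1)\<close> and an error \<open>o(P_s d)\<close>.

  A zero column or two equal columns occur with probability asymptotic to \<open>d\<^sup>2 / 2 ^ (d + 1)\<close>.
  A relation whose support has \<open>k \<ge> 3\<close> elements is determined by \<open>k - 1\<close> of the rows, and each of
  the other rows satisfies it with probability at most \<open>(k choose (k div 2)) / 2 ^ k\<close> by the
  Littlewood--Offord theorem; for \<open>k \<le> (1 - \<delta>) * d\<close> the union bound gives \<open>o(2 ^ -d)\<close>.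

  In the remaining case all relations between the first \<open>d - 1\<close> columns have support larger than
  \<open>(1 - \<delta>) * d\<close>. With probability at least \<open>1 / 2\<close> the last column is then outside the span of
  the others, that is, it takes part in no relation between the columns of the singular matrix. Such
  a matrix has at most \<open>\<delta> * d\<close> such columns (coloops in the language of matroids), so by the symmetry
  of the columns this happens with probability at most \<open>\<delta> * P_s d\<close>.
\<close>

unbundle no inner_syntax and no vec_syntax

section \<open>The Littlewood--Offord bound\<close>

text \<open>\<open>2 ^ k * lo_bound k r\<close> is the sum of the \<open>r\<close> largest binomial coefficients \<open>k choose i\<close>.\<close>

fun lo_bound :: "nat \<Rightarrow> nat \<Rightarrow> real" where
  "lo_bound 0 r = (if r = 0 then 0 else 1)"
| "lo_bound (Suc k) r = (if r = 0 then 0 else (lo_bound k (r + 1) + lo_bound k (r - 1)) / 2)"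

lemma lo_bound_0_right [simp]: "lo_bound k 0 = 0"
  by (cases k) auto

lemma lo_bound_nonneg: "0 \<le> lo_bound k r"
  by (induction k r rule: lo_bound.induct) auto

lemma lo_bound_le_1: "lo_bound k r \<le> 1"
proof (induction k arbitrary: r)
  case (Suc k)
  from Suc[of "r + 1"] Suc[of "r - 1"] show ?case by auto
qed auto

lemma lo_bound_concave: "lo_bound k r + lo_bound k (r + 2) \<le> 2 * lo_bound k (r + 1)"
proof (induction k arbitrary: r)
  case (Suc k)
  show ?case
  proof (cases r)
    case 0
    then show ?thesis using Suc[of 1] by (simp add: numeral_eq_Suc)
  next
    case (Suc q)
    then show ?thesis using Suc.IH[of q] Suc.IH[of "q + 2"]
      by (simp add: numeral_eq_Suc add_divide_distrib)
  qed
qed auto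

lemma lo_bound_Suc_le: "lo_bound (Suc k) r \<le> lo_bound k r"
proof (cases r)
  case (Suc q)
  then show ?thesis using lo_bound_concave[of k q] by simp
qed auto

lemma lo_bound_antimono: "k \<le> l \<Longrightarrow> lo_bound l r \<le> lo_bound k r"
  by (rule lift_Suc_antimono_le[of "\<lambda>k. lo_bound k r"]) (rule lo_bound_Suc_le)

lemma lo_bound_increment_antimono:
  "lo_bound k (r + m + 1) - lo_bound k (r + m) \<le> lo_bound k (r + 1) - lo_bound k r"
proof (induction m)
  case (Suc m)
  then show ?case using lo_bound_concave[of k "r + m"] by (simp add: numeral_eq_Suc)
qed auto

lemma lo_bound_spread:
  assumes "m < r"
  shows "lo_bound k (r + 1 + m) + lo_bound k (r - 1 - m) \<le> 2 * lo_bound (Suc k) r"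
  using assms
proof (induction m)
  case (Suc m)
  define q where "q = r - 2 - m"
  have shifts: "r - 1 - m = q + 1" "r - 1 - Suc m = q" "r + 1 + m = q + (2 * m + 3)"
      "r + 1 + Suc m = q + (2 * m + 3) + 1"
    using Suc.prems by (auto simp: q_def)
  have "lo_bound k (q + (2 * m + 3) + 1) - lo_bound k (q + (2 * m + 3))
      \<le> lo_bound k (q + 1) - lo_bound k q"
    by (rule lo_bound_increment_antimono)
  moreover have "lo_bound k (r + 1 + m) + lo_bound k (r - 1 - m) \<le> 2 * lo_bound (Suc k) r"
    using Suc by simp
  ultimately show ?case unfolding shifts by linarith
qed simp

lemma lo_bound_Un_Int:
  assumes "finite X" "finite Y" "card X = card Y" "X \<noteq> Y"
  shows "lo_bound k (card (X \<union> Y)) + lo_bound k (card (X \<inter> Y)) \<le> 2 * lo_bound (Suc k) (card X)"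
proof -
  have "X \<subset> X \<union> Y"
    using assms card_subset_eq[of X Y] by auto
  then have "card X < card (X \<union> Y)"
    using assms by (intro psubset_card_mono) auto
  then obtain m where card_Un: "card (X \<union> Y) = card X + 1 + m"
    by (auto simp: less_iff_Suc_add)
  moreover have "card (X \<union> Y) + card (X \<inter> Y) = 2 * card X"
    using card_Un_Int[of X Y] assms by simp
  ultimately have "card (X \<inter> Y) = card X - 1 - m" "m < card X"
    by linarith+
  then show ?thesis
    using lo_bound_spread[of m "card X" k] card_Un by simp
qed

lemma bounded_arithmetic_progression_eq_0:
  fixes h :: "nat \<Rightarrow> real"
  assumes "h 0 = 0" and second_difference: "\<And>r. h (r + 2) = 2 * h (r + 1) - h r"
    and bounded: "\<And>r. \<bar>h r\<bar> \<le> B"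
  shows "h r = 0"
proof -
  have linear: "h r = real r * h 1 \<and> h (Suc r) = real (Suc r) * h 1" for r
  proof (induction r)
    case (Suc r)
    then show ?case using second_difference[of r] by (simp add: algebra_simps)
  qed (use assms(1) in auto)
  have "h 1 = 0"
  proof (rule ccontr)
    assume "h 1 \<noteq> 0"
    then obtain r where "B < real r * \<bar>h 1\<bar>"
      using reals_Archimedean3[of "\<bar>h 1\<bar>"] by auto
    then show False
      using bounded[of r] linear[of r] by (simp add: abs_mult)
  qed
  then show ?thesis using linear[of r] by simp
qed

lemma convergent_lo_bound: "convergent (\<lambda>k. lo_bound k r)"
proof (rule Bseq_monoseq_convergent)
  show "Bseq (\<lambda>k. lo_bound k r)"
    by (rule BseqI'[where K = 1]) (use lo_bound_nonneg lo_bound_le_1 in auto)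
  show "monoseq (\<lambda>k. lo_bound k r)"
    by (rule decseq_imp_monoseq) (auto simp: decseq_def lo_bound_antimono)
qed

lemma lo_bound_tendsto_0: "(\<lambda>k. lo_bound k r) \<longlonglongrightarrow> 0"
proof -
  obtain h where lim: "\<And>r. (\<lambda>k. lo_bound k r) \<longlonglongrightarrow> h r"
    using convergent_lo_bound unfolding convergent_def by metis
  have "h r = 0"
  proof (rule bounded_arithmetic_progression_eq_0)
    show "h 0 = 0" using lim[of 0] by (simp add: LIMSEQ_const_iff)
  next
    fix r
    have "(\<lambda>k. (lo_bound k (r + 2) + lo_bound k r) / 2) \<longlonglongrightarrow> (h (r + 2) + h r) / 2"
      by (intro tendsto_intros lim) auto
    moreover have "(\<lambda>k. lo_bound (Suc k) (r + 1)) \<longlonglongrightarrow> h (r + 1)"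
      using lim by (rule LIMSEQ_Suc)
    ultimately have "(h (r + 2) + h r) / 2 = h (r + 1)"
      using LIMSEQ_unique by (fastforce simp: numeral_eq_Suc)
    then show "h (r + 2) = 2 * h (r + 1) - h r" by simp
  next
    fix r
    have "0 \<le> h r" by (rule LIMSEQ_le_const[OF lim]) (auto intro: lo_bound_nonneg)
    moreover have "h r \<le> 1" by (rule LIMSEQ_le_const2[OF lim]) (auto intro: lo_bound_le_1)
    ultimately show "\<bar>h r\<bar> \<le> 1" by simp
  qed
  then show ?thesis using lim by metis
qed

lemma sum_PiE_insert:
  assumes "a \<notin> N"
  shows "(\<Sum>x \<in> Pi\<^sub>E (insert a N) A. f x) = (\<Sum>x \<in> Pi\<^sub>E N A. \<Sum>y \<in> A a. f (x(a := y)))"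
proof -
  have "(\<Sum>x \<in> Pi\<^sub>E (insert a N) A. f x) = (\<Sum>(y, x) \<in> A a \<times> Pi\<^sub>E N A. f (x(a := y)))"
    unfolding PiE_insert_eq
    by (subst sum.reindex[OF inj_combinator[OF assms]]) (simp add: case_prod_unfold)
  also have "\<dots> = (\<Sum>x \<in> Pi\<^sub>E N A. \<Sum>y \<in> A a. f (x(a := y)))"
    by (subst sum.swap) (rule sum.cartesian_product[symmetric])
  finally show ?thesis .
qed

lemma card_PiE_insert_Collect:
  assumes "finite N" "a \<notin> N" "finite (A a)" "\<And>i. i \<in> N \<Longrightarrow> finite (A i)"
  shows "card {x \<in> Pi\<^sub>E (insert a N) A. P x} = (\<Sum>x \<in> Pi\<^sub>E N A. card {y \<in> A a. P (x(a := y))})"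
proof -
  have "finite (Pi\<^sub>E (insert a N) A)" using assms by (intro finite_PiE) auto
  then have "card {x \<in> Pi\<^sub>E (insert a N) A. P x} = (\<Sum>x \<in> Pi\<^sub>E (insert a N) A. of_bool (P x))"
    by (simp add: Int_def)
  also have "\<dots> = (\<Sum>x \<in> Pi\<^sub>E N A. \<Sum>y \<in> A a. of_bool (P (x(a := y))))"
    by (rule sum_PiE_insert[OF assms(2)])
  finally show ?thesis using assms(3) by (simp add: Int_def)
qed

definition cube_preimage :: "'j set \<Rightarrow> ('j \<Rightarrow> 'a::linordered_idom) \<Rightarrow> 'a set \<Rightarrow> ('j \<Rightarrow> 'a) set" where
  "cube_preimage N \<alpha> X = {x \<in> N \<rightarrow>\<^sub>E {0, 1}. (\<Sum>j\<in>N. \<alpha> j * x j) \<in> X}"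

lemma finite_cube_preimage: "finite N \<Longrightarrow> finite (cube_preimage N \<alpha> X)"
  by (simp add: cube_preimage_def finite_PiE)

lemma card_cube_preimage_insert:
  fixes \<alpha> :: "'j \<Rightarrow> 'a::linordered_idom"
  assumes "finite N" "a \<notin> N"
  shows "card (cube_preimage (insert a N) \<alpha> X)
    = card (cube_preimage N \<alpha> X) + card (cube_preimage N \<alpha> ((\<lambda>t. t - \<alpha> a) ` X))"
proof -
  have fiber: "card {y \<in> {0, 1}. (\<Sum>j\<in>insert a N. \<alpha> j * (x(a := y)) j) \<in> X}
      = of_bool ((\<Sum>j\<in>N. \<alpha> j * x j) \<in> X) + of_bool ((\<Sum>j\<in>N. \<alpha> j * x j) \<in> (\<lambda>t. t - \<alpha> a) ` X)" for x
  proof -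
    define s where "s = (\<Sum>j\<in>N. \<alpha> j * x j)"
    have sum_upd: "(\<Sum>j\<in>insert a N. \<alpha> j * (x(a := y)) j) = \<alpha> a * y + s" for y
      using assms unfolding s_def by (simp, intro sum.cong) auto
    have "s \<in> (\<lambda>t. t - \<alpha> a) ` X \<longleftrightarrow> \<alpha> a + s \<in> X"
      by (force simp: image_iff)
    moreover have "{y \<in> {0, 1}. \<alpha> a * y + s \<in> X}
        = (if s \<in> X then {0} else {}) \<union> (if \<alpha> a + s \<in> X then {1} else {})"
      by auto
    ultimately show ?thesis unfolding sum_upd s_def[symmetric] by simp
  qed
  have "card (cube_preimage (insert a N) \<alpha> X)
      = (\<Sum>x \<in> N \<rightarrow>\<^sub>E {0, 1}. card {y \<in> {0, 1}. (\<Sum>j\<in>insert a N. \<alpha> j * (x(a := y)) j) \<in> X})"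
    unfolding cube_preimage_def using assms by (intro card_PiE_insert_Collect) auto
  also have "\<dots> = (\<Sum>x \<in> N \<rightarrow>\<^sub>E {0, 1}. of_bool ((\<Sum>j\<in>N. \<alpha> j * x j) \<in> X)
      + of_bool ((\<Sum>j\<in>N. \<alpha> j * x j) \<in> (\<lambda>t. t - \<alpha> a) ` X))"
    by (simp only: fiber)
  also have "\<dots> = card (cube_preimage N \<alpha> X) + card (cube_preimage N \<alpha> ((\<lambda>t. t - \<alpha> a) ` X))"
    using assms(1) by (simp add: sum.distrib cube_preimage_def Int_def finite_PiE)
  finally show ?thesis .
qed

lemma card_cube_preimage_Un_Int:
  assumes "finite N"
  shows "card (cube_preimage N \<alpha> X) + card (cube_preimage N \<alpha> Y)
    = card (cube_preimage N \<alpha> (X \<union> Y)) + card (cube_preimage N \<alpha> (X \<inter> Y))"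
proof -
  have "cube_preimage N \<alpha> (X \<union> Y) = cube_preimage N \<alpha> X \<union> cube_preimage N \<alpha> Y"
    and "cube_preimage N \<alpha> (X \<inter> Y) = cube_preimage N \<alpha> X \<inter> cube_preimage N \<alpha> Y"
    by (auto simp: cube_preimage_def)
  then show ?thesis using card_Un_Int finite_cube_preimage[OF assms] by metis
qed

lemma translate_finite_set_neq:
  fixes X :: "'a::linordered_ab_group_add set"
  assumes "finite X" "X \<noteq> {}" "c \<noteq> 0"
  shows "(\<lambda>t. t - c) ` X \<noteq> X"
proof
  assume invariant: "(\<lambda>t. t - c) ` X = X"
  have "Min X - c \<in> X" "Max X - c \<in> X"
    using imageI[of _ X "\<lambda>t. t - c"] assms(1,2) by (simp_all add: invariant)
  then have "c \<le> 0" "0 \<le> c"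
    using Min_le[OF assms(1), of "Min X - c"] Max_ge[OF assms(1), of "Max X - c"] by simp_all
  with \<open>c \<noteq> 0\<close> show False by simp
qed

text \<open>With one more nonzero coefficient \<open>\<alpha> a\<close> the target set \<open>X\<close> is replaced by the pair
  of \<open>X\<close> and its translate \<open>Y\<close> by \<open>- \<alpha> a\<close>, or equally by \<open>X \<union> Y\<close> and \<open>X \<inter> Y\<close>; since \<open>X \<noteq> Y\<close>, the
  cardinalities of the latter are spread out and concavity applies.\<close>

lemma card_cube_preimage_insert_le:
  fixes \<alpha> :: "'j \<Rightarrow> 'a::linordered_idom"
  assumes "finite N" "a \<notin> N" "\<alpha> a \<noteq> 0" "finite X"
    and bound: "\<And>Z. finite Z \<Longrightarrow> card (cube_preimage N \<alpha> Z) \<le> lo_bound k (card Z) * 2 ^ card N"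
  shows "card (cube_preimage (insert a N) \<alpha> X) \<le> lo_bound (Suc k) (card X) * 2 ^ card (insert a N)"
proof (cases "X = {}")
  case True
  then show ?thesis by (simp add: cube_preimage_def)
next
  case False
  define Y where "Y = (\<lambda>t. t - \<alpha> a) ` X"
  have Y: "finite Y" "card Y = card X" "Y \<noteq> X"
    using assms(3,4) False translate_finite_set_neq[of X "\<alpha> a"]
    by (auto simp: Y_def inj_on_def intro!: card_image)
  have "card (cube_preimage (insert a N) \<alpha> X)
      = card (cube_preimage N \<alpha> X) + card (cube_preimage N \<alpha> Y)"
    unfolding Y_def by (rule card_cube_preimage_insert[OF assms(1,2)])
  also have "\<dots> = card (cube_preimage N \<alpha> (X \<union> Y)) + card (cube_preimage N \<alpha> (X \<inter> Y))"
    by (rule card_cube_preimage_Un_Int[OF assms(1)])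
  finally have "real (card (cube_preimage (insert a N) \<alpha> X))
      = card (cube_preimage N \<alpha> (X \<union> Y)) + card (cube_preimage N \<alpha> (X \<inter> Y))"
    by simp
  also have "\<dots> \<le> (lo_bound k (card (X \<union> Y)) + lo_bound k (card (X \<inter> Y))) * 2 ^ card N"
    using bound[of "X \<union> Y"] bound[of "X \<inter> Y"] assms(4) Y(1) by (simp add: distrib_right)
  also have "\<dots> \<le> (2 * lo_bound (Suc k) (card X)) * 2 ^ card N"
    using assms(4) Y by (intro mult_right_mono lo_bound_Un_Int) auto
  finally show ?thesis using assms(1,2) by (simp del: lo_bound.simps)
qed

theorem littlewood_offord:
  fixes \<alpha> :: "'j \<Rightarrow> 'a::linordered_idom"
  assumes "finite N" "finite X"
  shows "card (cube_preimage N \<alpha> X) \<le> lo_bound (card {j \<in> N. \<alpha> j \<noteq> 0}) (card X) * 2 ^ card N"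
  using assms
proof (induction N arbitrary: X rule: finite_induct)
  case empty
  have "card (cube_preimage {} \<alpha> X) \<le> card ({} \<rightarrow>\<^sub>E {0, 1 :: 'a} :: ('j \<Rightarrow> 'a) set)"
    unfolding cube_preimage_def by (rule card_mono) auto
  moreover have "X = {} \<Longrightarrow> cube_preimage {} \<alpha> X = {}"
    by (simp add: cube_preimage_def)
  ultimately show ?case using empty by auto
next
  case (insert a N)
  show ?case
  proof (cases "\<alpha> a = 0")
    case True
    then have "{j \<in> insert a N. \<alpha> j \<noteq> 0} = {j \<in> N. \<alpha> j \<noteq> 0}" by auto
    then show ?thesis
      using insert.IH[OF insert.prems] insert.hyps True by (simp add: card_cube_preimage_insert)
  next
    case False
    then have "{j \<in> insert a N. \<alpha> j \<noteq> 0} = insert a {j \<in> N. \<alpha> j \<noteq> 0}" by auto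
    then have "card {j \<in> insert a N. \<alpha> j \<noteq> 0} = Suc (card {j \<in> N. \<alpha> j \<noteq> 0})"
      using insert.hyps by simp
    then show ?thesis
      using card_cube_preimage_insert_le[of N a \<alpha> X] insert False by simp
  qed
qed

corollary card_cube_hyperplane_le:
  fixes \<alpha> :: "'j \<Rightarrow> 'a::linordered_idom"
  assumes "finite N" "J \<subseteq> N" "\<And>j. j \<in> J \<Longrightarrow> \<alpha> j \<noteq> 0"
  shows "card {x \<in> N \<rightarrow>\<^sub>E {0, 1}. (\<Sum>j\<in>J. x j * \<alpha> j) = 0} \<le> lo_bound (card J) 1 * 2 ^ card N"
proof -
  define \<beta> where "\<beta> j = (if j \<in> J then \<alpha> j else 0)" for j
  have "(\<Sum>j\<in>N. \<beta> j * x j) = (\<Sum>j\<in>J. x j * \<alpha> j)" for x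
    using assms(1,2) by (intro sum.mono_neutral_cong_right) (auto simp: \<beta>_def)
  then have "{x \<in> N \<rightarrow>\<^sub>E {0, 1}. (\<Sum>j\<in>J. x j * \<alpha> j) = 0} = cube_preimage N \<beta> {0}"
    by (simp add: cube_preimage_def)
  moreover have "{j \<in> N. \<beta> j \<noteq> 0} = J" using assms by (auto simp: \<beta>_def)
  ultimately show ?thesis using littlewood_offord[OF assms(1), of "{0}" \<beta>] by simp
qed

section \<open>Kernel vectors with a given support\<close>

definition kernel_on :: "'i set \<Rightarrow> 'j set \<Rightarrow> ('i \<Rightarrow> 'j \<Rightarrow> 'a::comm_ring) \<Rightarrow> ('j \<Rightarrow> 'a) set" where
  "kernel_on I J M = {x. \<forall>i\<in>I. (\<Sum>j\<in>J. M i j * x j) = 0}"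

lemma kernel_on_eliminate:
  fixes M :: "'i \<Rightarrow> 'j \<Rightarrow> 'a::field"
  assumes "finite J" "a \<notin> J" "M r a \<noteq> 0"
  shows "kernel_on (insert r I) (insert a J) M
    = kernel_on {r} (insert a J) M \<inter> kernel_on I J (\<lambda>i j. M i j - M i a / M r a * M r j)"
proof -
  define row where "row i x = (\<Sum>j\<in>insert a J. M i j * x j)" for i x
  have "(\<Sum>j\<in>J. (M i j - M i a / M r a * M r j) * x j) = row i x - M i a / M r a * row r x" for i x
  proof -
    have "(\<Sum>j\<in>J. (M i j - M i a / M r a * M r j) * x j)
        = (\<Sum>j\<in>J. M i j * x j) - M i a / M r a * (\<Sum>j\<in>J. M r j * x j)"
      by (simp add: left_diff_distrib sum_subtractf sum_distrib_left mult.assoc)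
    then show ?thesis using assms by (simp add: row_def distrib_left)
  qed
  then show ?thesis by (auto simp: kernel_on_def simp flip: row_def)
qed

lemma determining_rows:
  fixes M :: "'i \<Rightarrow> 'j \<Rightarrow> 'a::field"
  assumes "finite J"
  shows "\<exists>R\<subseteq>I. finite R \<and> card R \<le> card J \<and> kernel_on R J M \<subseteq> kernel_on I J M"
  using assms
proof (induction J arbitrary: M rule: finite_induct)
  case empty
  show ?case by (rule exI[of _ "{}"]) (auto simp: kernel_on_def)
next
  case (insert a J)
  show ?case
  proof (cases "\<forall>i\<in>I. M i a = 0")
    case True
    have drop_column: "kernel_on R (insert a J) M = kernel_on R J M" if "R \<subseteq> I" for R
      using that True insert.hyps by (auto simp: kernel_on_def subset_iff)
    obtain R where "R \<subseteq> I" "finite R" "card R \<le> card J" "kernel_on R J M \<subseteq> kernel_on I J M"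
      using insert.IH by blast
    then show ?thesis
      using insert.hyps by (intro exI[of _ R]) (simp add: drop_column)
  next
    case False
    then obtain r where r: "r \<in> I" "M r a \<noteq> 0" by auto
    define M' where "M' i j = M i j - M i a / M r a * M r j" for i j
    obtain R where R: "R \<subseteq> I" "finite R" "card R \<le> card J" "kernel_on R J M' \<subseteq> kernel_on I J M'"
      using insert.IH by blast
    have eliminate: "kernel_on (insert r S) (insert a J) M
        = kernel_on {r} (insert a J) M \<inter> kernel_on S J M'" for S
      unfolding M'_def using insert.hyps r(2) by (rule kernel_on_eliminate)
    have "kernel_on (insert r R) (insert a J) M \<subseteq> kernel_on (insert r I) (insert a J) M"
      unfolding eliminate[of R] eliminate[of I] using R(4) by blast
    moreover have "card (insert r R) \<le> card (insert a J)"
      using R insert.hyps by (auto simp: card_insert_if)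
    ultimately show ?thesis
      using R r(1) by (intro exI[of _ "insert r R"]) (auto simp: insert_absorb)
  qed
qed

lemma determining_rows_of_singular:
  fixes M :: "'i \<Rightarrow> 'j \<Rightarrow> 'a::field"
  assumes "finite J" "a \<in> J" and \<alpha>: "\<alpha> \<in> kernel_on I J M" "\<alpha> a \<noteq> 0"
    and "finite I" "card J - 1 \<le> card I"
  shows "\<exists>R\<subseteq>I. card R = card J - 1 \<and> kernel_on R J M \<subseteq> kernel_on I J M"
proof -
  obtain R where R: "R \<subseteq> I" "finite R" "card R \<le> card (J - {a})"
    "kernel_on R (J - {a}) M \<subseteq> kernel_on I (J - {a}) M"
    using determining_rows[of "J - {a}" I M] \<open>finite J\<close> by auto
  obtain R' where R': "R \<subseteq> R'" "R' \<subseteq> I" "card R' = card J - 1"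
    using exists_subset_between[of R "card J - 1" I] R assms by auto
  have "x \<in> kernel_on I J M" if "x \<in> kernel_on R' J M" for x
  proof -
    define y where "y j = x j - x a / \<alpha> a * \<alpha> j" for j
    have row: "(\<Sum>j\<in>J - {a}. M i j * y j) = (\<Sum>j\<in>J. M i j * x j)" if "i \<in> I" for i
    proof -
      have "(\<Sum>j\<in>J - {a}. M i j * y j) = (\<Sum>j\<in>J. M i j * y j)"
        using assms(1) \<alpha>(2) by (intro sum.mono_neutral_left) (auto simp: y_def)
      also have "\<dots> = (\<Sum>j\<in>J. M i j * x j) - x a / \<alpha> a * (\<Sum>j\<in>J. M i j * \<alpha> j)"
        by (simp add: y_def right_diff_distrib sum_subtractf sum_distrib_left mult_ac)
      finally show ?thesis using \<alpha>(1) that by (simp add: kernel_on_def)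
    qed
    have "y \<in> kernel_on R (J - {a}) M"
      using that R(1) R'(1) row unfolding kernel_on_def by (auto simp: subset_iff)
    then have "y \<in> kernel_on I (J - {a}) M" using R(4) by blast
    then show ?thesis using row by (simp add: kernel_on_def)
  qed
  then show ?thesis using R' by blast
qed

lemma card_PiE_restrict_le:
  fixes q :: real
  assumes "finite I" "finite Y" "R \<subseteq> I"
    and Z: "\<And>X. Z X \<subseteq> Y" "\<And>X. card (Z X) \<le> q"
  shows "card {M \<in> I \<rightarrow>\<^sub>E Y. \<forall>i\<in>I - R. M i \<in> Z (restrict M R)} \<le> card Y ^ card R * q ^ card (I - R)"
    (is "real (card ?S) \<le> _")
proof -
  define T where "T = (SIGMA X:R \<rightarrow>\<^sub>E Y. I - R \<rightarrow>\<^sub>E Z X)"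
  define split where "split M = (restrict M R, restrict M (I - R))" for M :: "'a \<Rightarrow> 'b"
  have finite_R: "finite R" and finite_Z: "finite (Z X)" for X
    using assms(1-3) Z(1) by (auto intro: finite_subset)
  have "inj_on split ?S"
  proof (rule inj_onI)
    fix M M' assume M: "M \<in> ?S" "M' \<in> ?S" "split M = split M'"
    then have "restrict M R i = restrict M' R i"
      and "restrict M (I - R) i = restrict M' (I - R) i" for i
      by (simp_all add: split_def)
    then have "M i = M' i" if "i \<in> I" for i
      using that by (cases "i \<in> R") (metis restrict_apply', metis DiffI restrict_apply')
    then show "M = M'" using M(1,2) by (intro PiE_ext[of M I "\<lambda>_. Y" M']) auto
  qed
  moreover have "split ` ?S \<subseteq> T"
    using \<open>R \<subseteq> I\<close> by (auto simp: split_def T_def)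
  moreover have "finite T"
    unfolding T_def using assms(1,2) finite_R finite_Z by (intro finite_SigmaI finite_PiE) auto
  ultimately have "card ?S \<le> card T" by (rule card_inj_on_le)
  also have "card T = (\<Sum>X \<in> R \<rightarrow>\<^sub>E Y. card (Z X) ^ card (I - R))"
    unfolding T_def using assms(1,2) finite_R finite_Z
    by (subst card_SigmaI) (auto simp: finite_PiE card_PiE)
  finally have "real (card ?S) \<le> (\<Sum>X \<in> R \<rightarrow>\<^sub>E Y. real (card (Z X)) ^ card (I - R))"
    by (simp flip: of_nat_power of_nat_sum)
  also have "\<dots> \<le> (\<Sum>X \<in> R \<rightarrow>\<^sub>E Y. q ^ card (I - R))"
    by (intro sum_mono power_mono Z) auto
  finally show ?thesis using finite_R by (simp add: card_PiE)
qed

lemma card_PiE_determined_le: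
  fixes q :: real
  assumes "finite I" "finite Y" "F \<subseteq> I \<rightarrow>\<^sub>E Y"
    and Z: "\<And>R X. Z R X \<subseteq> Y" "\<And>R X. card (Z R X) \<le> q"
    and determined: "\<And>M. M \<in> F \<Longrightarrow> \<exists>R\<subseteq>I. card R = k \<and> (\<forall>i\<in>I - R. M i \<in> Z R (restrict M R))"
  shows "card F \<le> real (card I choose k) * card Y ^ k * q ^ (card I - k)"
proof -
  define \<R> where "\<R> = {R. R \<subseteq> I \<and> card R = k}"
  define S where "S R = {M \<in> I \<rightarrow>\<^sub>E Y. \<forall>i\<in>I - R. M i \<in> Z R (restrict M R)}" for R
  have finite_\<R>: "finite \<R>" using assms(1) by (simp add: \<R>_def)
  have "F \<subseteq> (\<Union>R\<in>\<R>. S R)"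
    using assms(3) determined by (fastforce simp: \<R>_def S_def)
  then have "card F \<le> card (\<Union>R\<in>\<R>. S R)"
    using finite_\<R> assms(1,2) by (intro card_mono) (auto simp: S_def finite_PiE)
  also have "\<dots> \<le> (\<Sum>R\<in>\<R>. card (S R))" by (rule card_UN_le[OF finite_\<R>])
  finally have "real (card F) \<le> (\<Sum>R\<in>\<R>. real (card (S R)))"
    by (simp flip: of_nat_sum)
  also have "\<dots> \<le> (\<Sum>R\<in>\<R>. card Y ^ k * q ^ (card I - k))"
  proof (rule sum_mono)
    fix R assume "R \<in> \<R>"
    then have "R \<subseteq> I" "card R = k" "card (I - R) = card I - k"
      using assms(1) by (auto simp: \<R>_def card_Diff_subset finite_subset)
    then show "card (S R) \<le> card Y ^ k * q ^ (card I - k)"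
      using card_PiE_restrict_le[OF assms(1,2) \<open>R \<subseteq> I\<close> Z] by (simp add: S_def)
  qed
  finally show ?thesis using assms(1) by (simp add: \<R>_def n_subsets mult.assoc)
qed

definition nowhere_zero_kernel ::
    "'i set \<Rightarrow> 'j set \<Rightarrow> ('i \<Rightarrow> 'j \<Rightarrow> 'a::comm_ring) \<Rightarrow> ('j \<Rightarrow> 'a) set" where
  "nowhere_zero_kernel I J M = {\<alpha> \<in> kernel_on I J M. \<forall>j\<in>J. \<alpha> j \<noteq> 0}"

lemma nowhere_zero_kernel_determined:
  fixes M :: "'i \<Rightarrow> 'j \<Rightarrow> 'a::field"
  assumes "finite J" "J \<noteq> {}" "finite I" "card J - 1 \<le> card I" "nowhere_zero_kernel I J M \<noteq> {}"
  shows "\<exists>R\<subseteq>I. card R = card J - 1 \<and> nowhere_zero_kernel R J (restrict M R) \<noteq> {}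
    \<and> nowhere_zero_kernel R J (restrict M R) \<subseteq> nowhere_zero_kernel I J M"
proof -
  obtain \<alpha> a where \<alpha>: "\<alpha> \<in> nowhere_zero_kernel I J M" and "a \<in> J" using assms by auto
  then obtain R where R: "R \<subseteq> I" "card R = card J - 1" "kernel_on R J M \<subseteq> kernel_on I J M"
    using determining_rows_of_singular[of J a \<alpha> I M] assms by (auto simp: nowhere_zero_kernel_def)
  have kernel_restrict: "nowhere_zero_kernel R J (restrict M R) = nowhere_zero_kernel R J M"
    by (simp add: nowhere_zero_kernel_def kernel_on_def)
  have "\<alpha> \<in> nowhere_zero_kernel R J M"
    using \<alpha> R(1) by (auto simp: nowhere_zero_kernel_def kernel_on_def)
  moreover have "nowhere_zero_kernel R J M \<subseteq> nowhere_zero_kernel I J M"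
    using R(3) by (auto simp: nowhere_zero_kernel_def)
  ultimately show ?thesis
    using R(1,2) kernel_restrict by (intro exI[of _ R]) auto
qed

text \<open>The determining rows alone fix a kernel vector, to which all other rows must be orthogonal.\<close>

lemma card_nowhere_zero_kernel_le:
  assumes "finite I" "finite N" "J \<subseteq> N" "J \<noteq> {}" "card J - 1 \<le> card I"
  shows "card {M \<in> I \<rightarrow>\<^sub>E (N \<rightarrow>\<^sub>E {0, 1 :: 'a::linordered_field}). nowhere_zero_kernel I J M \<noteq> {}}
    \<le> real (card I choose (card J - 1)) * lo_bound (card J) 1 ^ (card I - (card J - 1))
      * 2 ^ (card N * card I)"
    (is "real (card ?F) \<le> _")
proof -
  define k where "k = card J - 1"
  define Y where "Y = N \<rightarrow>\<^sub>E {0, 1 :: 'a}"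
  define \<alpha> where "\<alpha> R X = (SOME \<alpha>. \<alpha> \<in> nowhere_zero_kernel R J X)"
    for R :: "'b set" and X :: "'b \<Rightarrow> 'c \<Rightarrow> 'a"
  have \<alpha>: "\<alpha> R X \<in> nowhere_zero_kernel R J X" if "nowhere_zero_kernel R J X \<noteq> {}" for R X
    using that by (simp add: \<alpha>_def some_in_eq)
  define Z where "Z R X = {x \<in> Y. nowhere_zero_kernel R J X \<noteq> {} \<and> (\<Sum>j\<in>J. x j * \<alpha> R X j) = 0}"
    for R X
  have "card ?F
      \<le> real (card I choose k) * card Y ^ k * (lo_bound (card J) 1 * 2 ^ card N) ^ (card I - k)"
  proof (rule card_PiE_determined_le[where Z = Z])
    show "card (Z R X) \<le> lo_bound (card J) 1 * 2 ^ card N" for R X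
    proof (cases "nowhere_zero_kernel R J X = {}")
      case False
      then show ?thesis
        using \<alpha>[OF False] card_cube_hyperplane_le[OF assms(2,3), of "\<alpha> R X"]
        by (simp add: Z_def Y_def nowhere_zero_kernel_def)
    qed (simp add: Z_def lo_bound_nonneg)
    fix M assume "M \<in> ?F"
    then have M: "M \<in> I \<rightarrow>\<^sub>E Y" "nowhere_zero_kernel I J M \<noteq> {}" by (auto simp: Y_def)
    obtain R where R: "R \<subseteq> I" "card R = k" "nowhere_zero_kernel R J (restrict M R) \<noteq> {}"
      "nowhere_zero_kernel R J (restrict M R) \<subseteq> nowhere_zero_kernel I J M"
      using nowhere_zero_kernel_determined[of J I M] M(2) assms by (auto simp: k_def finite_subset)
    then have "\<alpha> R (restrict M R) \<in> kernel_on I J M"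
      using \<alpha> unfolding nowhere_zero_kernel_def by blast
    then have "M i \<in> Z R (restrict M R)" if "i \<in> I" for i
      using M(1) R(3) that by (auto simp: Z_def kernel_on_def)
    then show "\<exists>R\<subseteq>I. card R = k \<and> (\<forall>i\<in>I - R. M i \<in> Z R (restrict M R))"
      using R(1,2) by auto
  qed (use assms in \<open>auto simp: Y_def Z_def finite_PiE\<close>)
  also have "\<dots> = real (card I choose k) * lo_bound (card J) 1 ^ (card I - k)
      * ((2 ^ card N) ^ k * (2 ^ card N) ^ (card I - k))"
    using assms(2) by (simp add: Y_def card_PiE numeral_2_eq_2 power_mult_distrib)
  also have "(2 ^ card N) ^ k * (2 ^ card N) ^ (card I - k) = (2 :: real) ^ (card N * card I)"
    using assms(5) by (simp add: k_def power_mult flip: power_add)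
  finally show ?thesis by (simp add: k_def)
qed

section \<open>Tuples of zero-one vectors\<close>

definition relations :: "nat \<Rightarrow> nat \<Rightarrow> (nat \<Rightarrow> real vec) \<Rightarrow> (nat \<Rightarrow> real) set" where
  "relations d n C = kernel_on {..<d} {..<n} (\<lambda>i j. C j $ i)"

definition support :: "nat \<Rightarrow> (nat \<Rightarrow> real) \<Rightarrow> nat set" where
  "support n \<alpha> = {j. j < n \<and> \<alpha> j \<noteq> 0}"

definition tuple_dep :: "nat \<Rightarrow> nat \<Rightarrow> (nat \<Rightarrow> real vec) \<Rightarrow> bool" where
  "tuple_dep d n C \<longleftrightarrow> (\<exists>\<alpha>\<in>relations d n C. support n \<alpha> \<noteq> {})"

definition tuple_span :: "nat \<Rightarrow> nat \<Rightarrow> (nat \<Rightarrow> real vec) \<Rightarrow> real vec set" where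
  "tuple_span d n C = {v \<in> carrier_vec d. \<exists>\<beta>. \<forall>i<d. v $ i = (\<Sum>j<n. C j $ i * \<beta> j)}"

definition zero_one_tuples :: "nat \<Rightarrow> nat \<Rightarrow> (nat \<Rightarrow> real vec) set" where
  "zero_one_tuples d n = {..<n} \<rightarrow>\<^sub>E zero_one_vecs d"

definition indep_tuples :: "nat \<Rightarrow> nat \<Rightarrow> (nat \<Rightarrow> real vec) set" where
  "indep_tuples d n = {C \<in> zero_one_tuples d n. \<not> tuple_dep d n C}"

definition tuple_prob :: "nat \<Rightarrow> nat \<Rightarrow> ((nat \<Rightarrow> real vec) \<Rightarrow> bool) \<Rightarrow> real" where
  "tuple_prob d n P = card {C \<in> zero_one_tuples d n. P C} / 2 ^ (d * n)"

lemma finite_support [simp]: "finite (support n \<alpha>)"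
  by (simp add: support_def)

lemma support_subset: "support n \<alpha> \<subseteq> {..<n}"
  by (auto simp: support_def)

lemma support_Suc_eq: "\<alpha> n = 0 \<Longrightarrow> support (Suc n) \<alpha> = support n \<alpha>"
  by (auto simp: support_def less_Suc_eq)

lemma zero_one_vecs_carrier: "v \<in> zero_one_vecs d \<Longrightarrow> v \<in> carrier_vec d"
  by (simp add: zero_one_vecs_def)

lemma bij_betw_zero_one_vecs:
  "bij_betw (\<lambda>v. \<lambda>i\<in>{..<d}. v $ i) (zero_one_vecs d) ({..<d} \<rightarrow>\<^sub>E {0, 1})"
proof (rule bij_betwI[where g = "vec d"])
  show "(\<lambda>v. \<lambda>i\<in>{..<d}. v $ i) \<in> zero_one_vecs d \<rightarrow> {..<d} \<rightarrow>\<^sub>E {0, 1}"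
    unfolding zero_one_vecs_def by (intro Pi_I restrict_PiE_iff[THEN iffD2]) auto
  show "vec d \<in> ({..<d} \<rightarrow>\<^sub>E {0, 1}) \<rightarrow> zero_one_vecs d"
    by (auto simp: zero_one_vecs_def PiE_iff)
qed (auto simp: zero_one_vecs_def fun_eq_iff PiE_iff extensional_def)

lemma finite_zero_one_vecs [simp]: "finite (zero_one_vecs d)"
  using bij_betw_finite[OF bij_betw_zero_one_vecs, of d] by (simp add: finite_PiE)

lemma card_zero_one_vecs: "card (zero_one_vecs d) = 2 ^ d"
  using bij_betw_same_card[OF bij_betw_zero_one_vecs, of d] by (simp add: card_PiE numeral_2_eq_2)

lemma finite_zero_one_tuples [simp]: "finite (zero_one_tuples d n)"
  by (simp add: zero_one_tuples_def finite_PiE)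

lemma card_zero_one_tuples: "card (zero_one_tuples d n) = 2 ^ (d * n)"
  by (simp add: zero_one_tuples_def card_PiE card_zero_one_vecs power_mult)

lemma zero_one_tuples_carrier: "C \<in> zero_one_tuples d n \<Longrightarrow> j < n \<Longrightarrow> C j \<in> carrier_vec d"
  by (auto simp: zero_one_tuples_def PiE_iff zero_one_vecs_carrier)

lemma card_zero_one_tuples_Suc:
  "card {C \<in> zero_one_tuples d (Suc n). P C}
    = (\<Sum>C\<in>zero_one_tuples d n. card {v \<in> zero_one_vecs d. P (C(n := v))})"
  unfolding zero_one_tuples_def lessThan_Suc by (rule card_PiE_insert_Collect) auto

lemma tuple_prob_mono:
  assumes "\<And>C. C \<in> zero_one_tuples d n \<Longrightarrow> P C \<Longrightarrow> Q C"
  shows "tuple_prob d n P \<le> tuple_prob d n Q"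
  unfolding tuple_prob_def using assms by (intro divide_right_mono of_nat_mono card_mono) auto

lemma tuple_prob_disj_le:
  "tuple_prob d n (\<lambda>C. P C \<or> Q C) \<le> tuple_prob d n P + tuple_prob d n Q"
proof -
  have "{C \<in> zero_one_tuples d n. P C \<or> Q C}
      = {C \<in> zero_one_tuples d n. P C} \<union> {C \<in> zero_one_tuples d n. Q C}" by auto
  then show ?thesis
    unfolding tuple_prob_def add_divide_distrib[symmetric] of_nat_add[symmetric]
    by (intro divide_right_mono of_nat_mono) (simp_all add: card_Un_le)
qed

lemma tuple_prob_bex_le:
  assumes "finite X"
  shows "tuple_prob d n (\<lambda>C. \<exists>x\<in>X. P x C) \<le> (\<Sum>x\<in>X. tuple_prob d n (P x))"
  using assms
proof (induction X rule: finite_induct)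
  case (insert x X)
  then show ?case
    using tuple_prob_disj_le[of d n "P x" "\<lambda>C. \<exists>x\<in>X. P x C"] by simp
qed (simp add: tuple_prob_def)

lemma tuple_prob_not: "tuple_prob d n (\<lambda>C. \<not> P C) = 1 - tuple_prob d n P"
proof -
  have "card {C \<in> zero_one_tuples d n. P C} + card {C \<in> zero_one_tuples d n. \<not> P C}
      = card (zero_one_tuples d n)"
    by (subst card_Un_disjoint[symmetric]) (auto intro: arg_cong[where f = card])
  then have "real (card {C \<in> zero_one_tuples d n. P C})
      + real (card {C \<in> zero_one_tuples d n. \<not> P C}) = 2 ^ (d * n)"
    by (simp add: card_zero_one_tuples flip: of_nat_add)
  then show ?thesis by (simp add: tuple_prob_def field_simps)
qed

lemma relations_iff: "\<alpha> \<in> relations d n C \<longleftrightarrow> (\<forall>i<d. (\<Sum>j<n. C j $ i * \<alpha> j) = 0)"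
  by (auto simp: relations_def kernel_on_def)

lemma relations_Suc_iff:
  "\<alpha> \<in> relations d (Suc n) (C(n := v)) \<longleftrightarrow> (\<forall>i<d. (\<Sum>j<n. C j $ i * \<alpha> j) + v $ i * \<alpha> n = 0)"
  by (simp add: relations_iff)

lemma relations_Suc_zero:
  "\<alpha> n = 0 \<Longrightarrow> \<alpha> \<in> relations d (Suc n) (C(n := v)) \<longleftrightarrow> \<alpha> \<in> relations d n C"
  unfolding relations_Suc_iff by (simp add: relations_iff)

lemma relation_imp_in_tuple_span:
  assumes "v \<in> carrier_vec d" "\<alpha> \<in> relations d (Suc n) (C(n := v))" "\<alpha> n \<noteq> 0"
  shows "v \<in> tuple_span d n C"
  unfolding tuple_span_def
proof (intro CollectI conjI exI[of _ "\<lambda>j. - \<alpha> j / \<alpha> n"] allI impI)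
  fix i assume "i < d"
  then have "(\<Sum>j<n. C j $ i * \<alpha> j) + v $ i * \<alpha> n = 0"
    using assms(2) by (simp add: relations_Suc_iff)
  then have "v $ i = - (\<Sum>j<n. C j $ i * \<alpha> j) / \<alpha> n"
    using assms(3) by (simp add: field_simps)
  also have "\<dots> = (\<Sum>j<n. C j $ i * (- \<alpha> j / \<alpha> n))"
    by (simp add: sum_negf sum_divide_distrib)
  finally show "v $ i = (\<Sum>j<n. C j $ i * (- \<alpha> j / \<alpha> n))" .
qed fact

lemma tuple_dep_Suc_iff:
  assumes "v \<in> carrier_vec d"
  shows "tuple_dep d (Suc n) (C(n := v)) \<longleftrightarrow> tuple_dep d n C \<or> v \<in> tuple_span d n C"
proof
  assume "tuple_dep d (Suc n) (C(n := v))"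
  then obtain \<alpha> where \<alpha>: "\<alpha> \<in> relations d (Suc n) (C(n := v))" "support (Suc n) \<alpha> \<noteq> {}"
    by (auto simp: tuple_dep_def)
  then show "tuple_dep d n C \<or> v \<in> tuple_span d n C"
    using relation_imp_in_tuple_span[OF assms \<alpha>(1)]
    by (cases "\<alpha> n = 0") (auto simp: relations_Suc_zero support_Suc_eq tuple_dep_def)
next
  assume "tuple_dep d n C \<or> v \<in> tuple_span d n C"
  then show "tuple_dep d (Suc n) (C(n := v))"
  proof
    assume "tuple_dep d n C"
    then obtain \<alpha> where \<alpha>: "\<alpha> \<in> relations d n C" "support n \<alpha> \<noteq> {}"
      by (auto simp: tuple_dep_def)
    have "\<alpha>(n := 0) \<in> relations d (Suc n) (C(n := v))"
      using \<alpha>(1) by (simp add: relations_iff)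
    moreover have "support (Suc n) (\<alpha>(n := 0)) = support n \<alpha>"
      by (auto simp: support_def)
    ultimately show ?thesis using \<alpha>(2) by (auto simp: tuple_dep_def)
  next
    assume "v \<in> tuple_span d n C"
    then obtain \<beta> where "\<forall>i<d. v $ i = (\<Sum>j<n. C j $ i * \<beta> j)" by (auto simp: tuple_span_def)
    then have "\<beta>(n := -1) \<in> relations d (Suc n) (C(n := v))"
      by (simp add: relations_Suc_iff)
    moreover have "n \<in> support (Suc n) (\<beta>(n := -1))" by (simp add: support_def)
    ultimately show ?thesis by (auto simp: tuple_dep_def)
  qed
qed

lemma tuple_dep_if_not_inj:
  assumes "\<not> inj_on C {..<n}"
  shows "tuple_dep d n C"
proof -
  obtain j l where jl: "j < n" "l < n" "j \<noteq> l" "C j = C l" using assms by (auto simp: inj_on_def)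
  define \<alpha> :: "nat \<Rightarrow> real" where "\<alpha> m = of_bool (m = j) - of_bool (m = l)" for m
  have "\<alpha> \<in> relations d n C"
    using jl by (simp add: relations_iff \<alpha>_def right_diff_distrib sum_subtractf)
  moreover have "j \<in> support n \<alpha>" using jl by (simp add: support_def \<alpha>_def)
  ultimately show ?thesis by (auto simp: tuple_dep_def)
qed

lemma tuple_dep_if_zero:
  assumes "j < n" "C j = 0\<^sub>v d"
  shows "tuple_dep d n C"
proof -
  define \<alpha> :: "nat \<Rightarrow> real" where "\<alpha> m = of_bool (m = j)" for m
  have "\<alpha> \<in> relations d n C"
    using assms by (simp add: relations_iff \<alpha>_def)
  moreover have "j \<in> support n \<alpha>" using assms by (simp add: support_def \<alpha>_def)
  ultimately show ?thesis by (auto simp: tuple_dep_def)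
qed

lemma exists_orthogonal_vec:
  fixes C :: "nat \<Rightarrow> 'a::idom vec"
  assumes "n < d" "\<And>j. j < n \<Longrightarrow> C j \<in> carrier_vec d"
  shows "\<exists>y\<in>carrier_vec d. y \<noteq> 0\<^sub>v d \<and> (\<forall>j<n. C j \<bullet> y = 0)"
proof -
  define row where "row j = (if j < n then C j else 0\<^sub>v d)" for j
  define A where "A = mat\<^sub>r d d (\<lambda>j. if j = n then 0\<^sub>v d else row j)"
  have A: "A \<in> carrier_mat d d" by (simp add: A_def)
  have "det A = 0"
    unfolding A_def using assms by (intro det_row_0) (auto simp: row_def)
  then obtain y where y: "y \<in> carrier_vec d" "y \<noteq> 0\<^sub>v d" "A *\<^sub>v y = 0\<^sub>v d"
    using det_0_iff_vec_prod_zero[OF A] by auto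
  have "C j \<bullet> y = 0" if "j < n" for j
  proof -
    have "C j \<bullet> y = (A *\<^sub>v y) $ j"
      using that assms by (simp add: A_def row_def)
    then show ?thesis using y(3) that assms(1) by simp
  qed
  then show ?thesis using y(1,2) by blast
qed

lemma tuple_span_orthogonal:
  assumes v: "v \<in> tuple_span d n C" and y: "y \<in> carrier_vec d" "\<And>j. j < n \<Longrightarrow> C j \<bullet> y = 0"
  shows "v \<bullet> y = 0"
proof -
  obtain \<beta> where \<beta>: "\<And>i. i < d \<Longrightarrow> v $ i = (\<Sum>j<n. C j $ i * \<beta> j)"
    using v by (auto simp: tuple_span_def)
  have "v \<bullet> y = (\<Sum>i<d. v $ i * y $ i)"
    using y(1) by (simp add: scalar_prod_def lessThan_atLeast0)
  also have "\<dots> = (\<Sum>i<d. \<Sum>j<n. \<beta> j * (C j $ i * y $ i))"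
    by (intro sum.cong refl) (simp add: \<beta> sum_distrib_left mult_ac)
  also have "\<dots> = (\<Sum>j<n. \<beta> j * (\<Sum>i<d. C j $ i * y $ i))"
    by (subst sum.swap) (simp add: sum_distrib_left)
  also have "\<dots> = (\<Sum>j<n. \<beta> j * (C j \<bullet> y))"
    using y(1) by (simp add: scalar_prod_def lessThan_atLeast0)
  finally show ?thesis by (simp add: y(2))
qed

lemma card_zero_one_vecs_hyperplane_le:
  assumes y: "y \<in> carrier_vec d" "y \<noteq> 0\<^sub>v d"
  shows "2 * card {v \<in> zero_one_vecs d. v \<bullet> y = 0} \<le> 2 ^ d"
proof -
  define J where "J = {i. i < d \<and> y $ i \<noteq> 0}"
  define T where "T = {x \<in> {..<d} \<rightarrow>\<^sub>E {0, 1 :: real}. (\<Sum>i\<in>J. x i * y $ i) = 0}"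
  define entries where "entries v = (\<lambda>i\<in>{..<d}. v $ i)" for v :: "real vec"
  have J: "J \<subseteq> {..<d}" "finite J" "J \<noteq> {}" using y by (auto simp: J_def vec_eq_iff)
  have nonzero: "y $ i \<noteq> 0" if "i \<in> J" for i using that by (simp add: J_def)
  have "card {v \<in> zero_one_vecs d. v \<bullet> y = 0} \<le> card T"
  proof (rule card_inj_on_le)
    have bij: "bij_betw entries (zero_one_vecs d) ({..<d} \<rightarrow>\<^sub>E {0, 1})"
      unfolding entries_def by (rule bij_betw_zero_one_vecs)
    show "inj_on entries {v \<in> zero_one_vecs d. v \<bullet> y = 0}"
      by (rule inj_on_subset[OF bij_betw_imp_inj_on[OF bij]]) auto
    have "v \<bullet> y = (\<Sum>i\<in>J. entries v i * y $ i)" for v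
      using y(1) unfolding scalar_prod_def
      by (intro sum.mono_neutral_cong_right) (auto simp: J_def entries_def)
    then show "entries ` {v \<in> zero_one_vecs d. v \<bullet> y = 0} \<subseteq> T"
      using bij_betwE[OF bij] by (intro image_subsetI) (simp add: T_def)
    show "finite T" by (simp add: T_def finite_PiE)
  qed
  also have "real (card T) \<le> lo_bound (card J) 1 * 2 ^ d"
    using card_cube_hyperplane_le[OF _ J(1), of "\<lambda>i. y $ i"] nonzero by (simp add: T_def)
  also have "\<dots> \<le> lo_bound 1 1 * 2 ^ d"
    using J by (intro mult_right_mono lo_bound_antimono) (simp_all add: Suc_le_eq card_gt_0_iff)
  finally have "real (2 * card {v \<in> zero_one_vecs d. v \<bullet> y = 0}) \<le> real (2 ^ d)" by simp
  then show ?thesis by (simp only: of_nat_le_iff)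
qed

lemma card_zero_one_vecs_tuple_span_le:
  assumes "n < d" "C \<in> zero_one_tuples d n"
  shows "2 * card (zero_one_vecs d \<inter> tuple_span d n C) \<le> 2 ^ d"
proof -
  obtain y where y: "y \<in> carrier_vec d" "y \<noteq> 0\<^sub>v d" "\<And>j. j < n \<Longrightarrow> C j \<bullet> y = 0"
    using exists_orthogonal_vec[of n d C] assms zero_one_tuples_carrier by blast
  then have "zero_one_vecs d \<inter> tuple_span d n C \<subseteq> {v \<in> zero_one_vecs d. v \<bullet> y = 0}"
    using tuple_span_orthogonal by blast
  then have "card (zero_one_vecs d \<inter> tuple_span d n C) \<le> card {v \<in> zero_one_vecs d. v \<bullet> y = 0}"
    by (intro card_mono) auto
  then show ?thesis using card_zero_one_vecs_hyperplane_le[OF y(1,2)] by linarith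
qed

section \<open>The singularity probability and the expected number of spanned vectors\<close>

lemma invertible_mat_iff_det:
  fixes A :: "'a::field mat"
  assumes A: "A \<in> carrier_mat n n"
  shows "invertible_mat A \<longleftrightarrow> det A \<noteq> 0"
proof
  assume "invertible_mat A"
  then obtain B where AB: "A * B = 1\<^sub>m n" and BA: "B * A = 1\<^sub>m (dim_row B)"
    using A by (auto simp: invertible_mat_def inverts_mat_def)
  have "dim_row B = n" using arg_cong[OF BA, of dim_col] A by simp
  moreover have "dim_col B = n" using arg_cong[OF AB, of dim_col] by simp
  ultimately have "det A * det B = 1"
    using det_mult[OF A, of B] AB by auto
  then show "det A \<noteq> 0" by auto
next
  assume "det A \<noteq> 0"
  then obtain B where "B \<in> carrier_mat n n" "A * B = 1\<^sub>m n" "B * A = 1\<^sub>m n"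
    using det_non_zero_imp_unit[OF A, of "()"] by (auto simp: Units_def ring_mat_def)
  then show "invertible_mat A" using A by (auto simp: invertible_mat_def inverts_mat_def)
qed

definition tuple_mat :: "nat \<Rightarrow> (nat \<Rightarrow> real vec) \<Rightarrow> real mat" where
  "tuple_mat d C = mat d d (\<lambda>(i, j). C j $ i)"

lemma singular_tuple_mat_iff: "singular_mat (tuple_mat d C) \<longleftrightarrow> tuple_dep d d C"
proof -
  have carrier: "tuple_mat d C \<in> carrier_mat d d" by (simp add: tuple_mat_def)
  have kernel: "tuple_mat d C *\<^sub>v v = 0\<^sub>v d \<longleftrightarrow> ($) v \<in> relations d d C" if "v \<in> carrier_vec d" for v
    using that
    by (auto simp: tuple_mat_def relations_iff vec_eq_iff scalar_prod_def lessThan_atLeast0)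
  have nonzero: "v \<noteq> 0\<^sub>v d \<longleftrightarrow> support d (($) v) \<noteq> {}" if "v \<in> carrier_vec d" for v :: "real vec"
    using that by (auto simp: vec_eq_iff support_def)
  have "singular_mat (tuple_mat d C)
      \<longleftrightarrow> (\<exists>v\<in>carrier_vec d. ($) v \<in> relations d d C \<and> support d (($) v) \<noteq> {})"
    using invertible_mat_iff_det[OF carrier] det_0_iff_vec_prod_zero[OF carrier] kernel nonzero
    by (auto simp: singular_mat_def)
  also have "\<dots> \<longleftrightarrow> tuple_dep d d C"
  proof
    assume "tuple_dep d d C"
    then obtain \<alpha> where "\<alpha> \<in> relations d d C" "support d \<alpha> \<noteq> {}" by (auto simp: tuple_dep_def)
    then have "($) (vec d \<alpha>) \<in> relations d d C" "support d (($) (vec d \<alpha>)) \<noteq> {}"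
      by (simp_all add: relations_iff support_def cong: conj_cong)
    then show "\<exists>v\<in>carrier_vec d. ($) v \<in> relations d d C \<and> support d (($) v) \<noteq> {}"
      using vec_carrier by blast
  qed (auto simp: tuple_dep_def)
  finally show ?thesis .
qed

lemma bij_betw_tuple_mat: "bij_betw (tuple_mat d) (zero_one_tuples d d) (zero_one_mats d)"
proof (rule bij_betwI[where g = "\<lambda>A. \<lambda>j\<in>{..<d}. vec d (\<lambda>i. A $$ (i, j))"])
  show "tuple_mat d \<in> zero_one_tuples d d \<rightarrow> zero_one_mats d"
    by (auto simp: zero_one_tuples_def tuple_mat_def zero_one_mats_def zero_one_vecs_def PiE_iff)
  show "(\<lambda>A. \<lambda>j\<in>{..<d}. vec d (\<lambda>i. A $$ (i, j))) \<in> zero_one_mats d \<rightarrow> zero_one_tuples d d"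
    unfolding zero_one_tuples_def
    by (intro Pi_I restrict_PiE_iff[THEN iffD2]) (auto simp: zero_one_mats_def zero_one_vecs_def)
next
  fix C assume C: "C \<in> zero_one_tuples d d"
  show "(\<lambda>j\<in>{..<d}. vec d (\<lambda>i. tuple_mat d C $$ (i, j))) = C"
  proof
    fix j
    show "(\<lambda>j\<in>{..<d}. vec d (\<lambda>i. tuple_mat d C $$ (i, j))) j = C j"
    proof (cases "j < d")
      case True
      then show ?thesis using zero_one_tuples_carrier[OF C True] by (auto simp: tuple_mat_def)
    next
      case False
      then show ?thesis using C by (auto simp: zero_one_tuples_def PiE_iff extensional_def)
    qed
  qed
qed (auto simp: tuple_mat_def zero_one_mats_def)

lemma P_s_nonneg: "0 \<le> P_s d" and P_s_le_1: "P_s d \<le> 1"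
  by (simp_all add: P_s_def)

lemma expected_spanned_nonneg: "0 \<le> expected_spanned d"
  by (simp add: expected_spanned_def sum_nonneg)

lemma P_s_eq_tuple_prob: "P_s d = tuple_prob d d (tuple_dep d d)"
proof -
  have bij: "bij_betw (tuple_mat d) (zero_one_tuples d d) (zero_one_mats d)"
    by (rule bij_betw_tuple_mat)
  have card_mats: "card (zero_one_mats d) = 2 ^ (d * d)"
    using bij_betw_same_card[OF bij] by (simp add: card_zero_one_tuples)
  then have "zero_one_mats d \<noteq> {}" by auto
  then have "P_s d = card {A \<in> zero_one_mats d. singular_mat A} / 2 ^ (d * d)"
    unfolding P_s_def using bij_betw_finite[OF bij]
    by (simp add: measure_pmf_of_set card_mats Int_def)
  moreover have "bij_betw (tuple_mat d) {C \<in> zero_one_tuples d d. tuple_dep d d C}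
      {A \<in> zero_one_mats d. singular_mat A}"
    using bij by (rule bij_betw_subset)
      (auto simp: singular_tuple_mat_iff bij_betw_imp_surj_on[OF bij, symmetric])
  ultimately show ?thesis
    by (simp add: tuple_prob_def bij_betw_same_card)
qed

lemma (in vec_space) lincomb_image_index:
  assumes "C ` J \<subseteq> carrier_vec n" "inj_on C J" "i < n"
  shows "lincomb a (C ` J) $ i = (\<Sum>j\<in>J. C j $ i * a (C j))"
  using assms by (simp add: lincomb_index sum.reindex mult.commute)

lemma (in vec_space) lincomb_inv_into_index:
  assumes "C ` J \<subseteq> carrier_vec n" "inj_on C J" "i < n"
  shows "lincomb (\<alpha> \<circ> inv_into J C) (C ` J) $ i = (\<Sum>j\<in>J. C j $ i * \<alpha> j)"
  using assms by (simp add: lincomb_image_index)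

lemma (in vec_space) lin_dep_image_iff:
  assumes "finite J" and C: "C ` J \<subseteq> carrier_vec n" and inj: "inj_on C J"
  shows "lin_dep (C ` J) \<longleftrightarrow> (\<exists>\<alpha>\<in>kernel_on {..<n} J (\<lambda>i j. C j $ i). \<exists>j\<in>J. \<alpha> j \<noteq> 0)"
proof
  assume "lin_dep (C ` J)"
  then obtain a v where a: "lincomb a (C ` J) = 0\<^sub>v n" "v \<in> C ` J" "a v \<noteq> 0"
    using finite_lin_dep[of "C ` J"] \<open>finite J\<close> C by auto
  have "(\<Sum>j\<in>J. C j $ i * (a \<circ> C) j) = 0" if "i < n" for i
    using lincomb_image_index[OF C inj that, of a] a(1) that by simp
  then have "a \<circ> C \<in> kernel_on {..<n} J (\<lambda>i j. C j $ i)"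
    by (simp add: kernel_on_def)
  then show "\<exists>\<alpha>\<in>kernel_on {..<n} J (\<lambda>i j. C j $ i). \<exists>j\<in>J. \<alpha> j \<noteq> 0"
    using a(2,3) by (intro bexI[of _ "a \<circ> C"]) auto
next
  assume "\<exists>\<alpha>\<in>kernel_on {..<n} J (\<lambda>i j. C j $ i). \<exists>j\<in>J. \<alpha> j \<noteq> 0"
  then obtain \<alpha> j where \<alpha>: "\<alpha> \<in> kernel_on {..<n} J (\<lambda>i j. C j $ i)" "j \<in> J" "\<alpha> j \<noteq> 0" by blast
  have "lincomb (\<alpha> \<circ> inv_into J C) (C ` J) = 0\<^sub>v n"
    using \<alpha>(1) \<open>finite J\<close> C
    by (intro eq_vecI) (simp_all add: lincomb_inv_into_index[OF C inj] kernel_on_def lincomb_dim)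
  then show "lin_dep (C ` J)"
    using \<alpha>(2,3) inj \<open>finite J\<close>
    by (intro lin_dep_crit[where A = "C ` J" and a = "\<alpha> \<circ> inv_into J C" and v = "C j"]) auto
qed

lemma (in vec_space) span_image:
  assumes "finite J" and C: "C ` J \<subseteq> carrier_vec n" and inj: "inj_on C J"
  shows "span (C ` J) = {v \<in> carrier_vec n. \<exists>\<beta>. \<forall>i<n. v $ i = (\<Sum>j\<in>J. C j $ i * \<beta> j)}"
proof (intro equalityI subsetI)
  fix v assume v: "v \<in> span (C ` J)"
  then obtain a where "v = lincomb a (C ` J)"
    unfolding finite_span[OF finite_imageI[OF \<open>finite J\<close>] C] by blast
  then have "\<forall>i<n. v $ i = (\<Sum>j\<in>J. C j $ i * (a \<circ> C) j)"
    by (simp add: lincomb_image_index[OF C inj])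
  then show "v \<in> {v \<in> carrier_vec n. \<exists>\<beta>. \<forall>i<n. v $ i = (\<Sum>j\<in>J. C j $ i * \<beta> j)}"
    using span_closed[OF C v] by blast
next
  fix v assume "v \<in> {v \<in> carrier_vec n. \<exists>\<beta>. \<forall>i<n. v $ i = (\<Sum>j\<in>J. C j $ i * \<beta> j)}"
  then obtain \<beta> where v: "v \<in> carrier_vec n" "\<forall>i<n. v $ i = (\<Sum>j\<in>J. C j $ i * \<beta> j)" by blast
  have "v = lincomb (\<beta> \<circ> inv_into J C) (C ` J)"
    using v \<open>finite J\<close> C
    by (intro eq_vecI) (simp_all add: lincomb_inv_into_index[OF C inj] lincomb_dim)
  then show "v \<in> span (C ` J)"
    unfolding finite_span[OF finite_imageI[OF \<open>finite J\<close>] C] by auto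
qed

lemma lin_indpt_image_iff:
  assumes "C \<in> zero_one_tuples d n" "inj_on C {..<n}"
  shows "real_lin_indpt d (C ` {..<n}) \<longleftrightarrow> \<not> tuple_dep d n C"
proof -
  have "C ` {..<n} \<subseteq> carrier_vec d" using zero_one_tuples_carrier assms(1) by auto
  then show ?thesis
    using vec_space.lin_dep_image_iff[of "{..<n}" C d] assms(2)
    by (auto simp: tuple_dep_def relations_def support_def)
qed

lemma real_span_image:
  assumes "C \<in> zero_one_tuples d n" "inj_on C {..<n}"
  shows "real_span d (C ` {..<n}) = tuple_span d n C"
proof -
  have "C ` {..<n} \<subseteq> carrier_vec d" using zero_one_tuples_carrier assms(1) by auto
  then show ?thesis
    using vec_space.span_image[of "{..<n}" C d] assms(2) by (simp add: tuple_span_def)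
qed

lemma sum_inj_on_PiE_image:
  fixes f :: "'b set \<Rightarrow> 'c::comm_semiring_1"
  assumes "finite I" "finite A"
  shows "(\<Sum>C | C \<in> I \<rightarrow>\<^sub>E A \<and> inj_on C I \<and> P (C ` I). f (C ` I))
    = of_nat (fact (card I)) * (\<Sum>G | G \<subseteq> A \<and> card G = card I \<and> P G. f G)"
proof -
  define S where "S = {C. C \<in> I \<rightarrow>\<^sub>E A \<and> inj_on C I \<and> P (C ` I)}"
  define T where "T = {G. G \<subseteq> A \<and> card G = card I \<and> P G}"
  have "finite S" using assms by (auto simp: S_def finite_PiE intro: finite_subset[of _ "I \<rightarrow>\<^sub>E A"])
  have "finite T" using assms by (auto simp: T_def intro: finite_subset[of _ "Pow A"])
  have "(\<lambda>C. C ` I) ` S \<subseteq> T" by (auto simp: S_def T_def card_image)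
  have fiber: "card {C \<in> S. C ` I = G} = fact (card I)" if "G \<in> T" for G
  proof -
    have G: "G \<subseteq> A" "card G = card I" "P G" "finite G"
      using that assms(2) by (auto simp: T_def finite_subset)
    have "C ` I = G" if "C \<in> I \<rightarrow>\<^sub>E G" "inj_on C I" for C
      using that G by (intro card_subset_eq) (auto simp: card_image)
    then have "{C \<in> S. C ` I = G} = {C \<in> I \<rightarrow>\<^sub>E G. inj_on C I}"
      using G(1,3) by (auto simp: S_def PiE_iff)
    also have "card \<dots> = fact (card I)"
      using card_inj_on_subset_funcset[of I G I] assms(1) G
        fact_prod_rev[of "card I", where 'a = nat] by simp
    finally show ?thesis .
  qed
  have "(\<Sum>C\<in>S. f (C ` I)) = (\<Sum>G\<in>T. \<Sum>C | C \<in> S \<and> C ` I = G. f (C ` I))"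
    by (rule sum.group[symmetric]) fact+
  also have "\<dots> = (\<Sum>G\<in>T. of_nat (fact (card I)) * f G)"
  proof (intro sum.cong refl)
    fix G assume "G \<in> T"
    have "(\<Sum>C | C \<in> S \<and> C ` I = G. f (C ` I)) = (\<Sum>C | C \<in> S \<and> C ` I = G. f G)"
      by (intro sum.cong) auto
    then show "(\<Sum>C | C \<in> S \<and> C ` I = G. f (C ` I)) = of_nat (fact (card I)) * f G"
      using fiber[OF \<open>G \<in> T\<close>] by simp
  qed
  finally show ?thesis by (simp add: S_def T_def sum_distrib_left)
qed

lemma sum_indep_tuples_image:
  fixes f :: "real vec set \<Rightarrow> real"
  shows "(\<Sum>C\<in>indep_tuples d (d - 1). f (C ` {..<d - 1}))
    = fact (d - 1) * (\<Sum>G\<in>lin_indpt_sets d. f G)"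
proof -
  have "indep_tuples d (d - 1) = {C. C \<in> {..<d - 1} \<rightarrow>\<^sub>E zero_one_vecs d
      \<and> inj_on C {..<d - 1} \<and> real_lin_indpt d (C ` {..<d - 1})}"
    using lin_indpt_image_iff tuple_dep_if_not_inj
    unfolding indep_tuples_def zero_one_tuples_def by blast
  moreover have "lin_indpt_sets d
      = {G. G \<subseteq> zero_one_vecs d \<and> card G = card {..<d - 1} \<and> real_lin_indpt d G}"
    by (simp add: lin_indpt_sets_def)
  ultimately show ?thesis
    using sum_inj_on_PiE_image[of "{..<d - 1}" "zero_one_vecs d" f "real_lin_indpt d"] by simp
qed

lemma sum_card_tuple_span:
  "(\<Sum>C\<in>indep_tuples d (d - 1). real (card (zero_one_vecs d \<inter> tuple_span d (d - 1) C)))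
    = real (card (indep_tuples d (d - 1))) * expected_spanned d"
proof -
  have "card (zero_one_vecs d \<inter> tuple_span d (d - 1) C) = num_spanned d (C ` {..<d - 1})"
    if "C \<in> indep_tuples d (d - 1)" for C
  proof -
    have "inj_on C {..<d - 1}" using that tuple_dep_if_not_inj by (auto simp: indep_tuples_def)
    then show ?thesis
      using that by (simp add: indep_tuples_def num_spanned_def real_span_image)
  qed
  then have "(\<Sum>C\<in>indep_tuples d (d - 1). real (card (zero_one_vecs d \<inter> tuple_span d (d - 1) C)))
      = (\<Sum>C\<in>indep_tuples d (d - 1). real (num_spanned d (C ` {..<d - 1})))"
    by (intro sum.cong refl) simp
  also have "\<dots> = fact (d - 1) * (\<Sum>G\<in>lin_indpt_sets d. real (num_spanned d G))"
    by (rule sum_indep_tuples_image)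
  also have "\<dots> = (fact (d - 1) * real (card (lin_indpt_sets d))) * expected_spanned d"
    by (cases "card (lin_indpt_sets d) = 0") (auto simp: expected_spanned_def card_eq_0_iff)
  also have "fact (d - 1) * real (card (lin_indpt_sets d)) = real (card (indep_tuples d (d - 1)))"
    using sum_indep_tuples_image[of "\<lambda>_. 1" d] by simp
  finally show ?thesis .
qed

lemma tuple_prob_tuple_dep_Suc:
  "tuple_prob d (Suc n) (tuple_dep d (Suc n)) = tuple_prob d n (tuple_dep d n)
    + (\<Sum>C\<in>indep_tuples d n. real (card (zero_one_vecs d \<inter> tuple_span d n C))) / 2 ^ (d * Suc n)"
proof -
  define extensions where
    "extensions C = card {v \<in> zero_one_vecs d. tuple_dep d (Suc n) (C(n := v))}" for C
  have extensions_iff: "extensions C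
      = card {v \<in> zero_one_vecs d. tuple_dep d n C \<or> v \<in> tuple_span d n C}" for C
    by (simp add: extensions_def tuple_dep_Suc_iff zero_one_vecs_carrier cong: conj_cong)
  have "real (card {C \<in> zero_one_tuples d (Suc n). tuple_dep d (Suc n) C})
      = (\<Sum>C\<in>zero_one_tuples d n. real (extensions C))"
    by (simp add: card_zero_one_tuples_Suc extensions_def)
  also have "\<dots> = (\<Sum>C | C \<in> zero_one_tuples d n \<and> tuple_dep d n C. real (extensions C))
      + (\<Sum>C\<in>indep_tuples d n. real (extensions C))"
    by (subst sum.union_disjoint[symmetric]) (auto simp: indep_tuples_def intro!: sum.cong)
  also have "(\<Sum>C | C \<in> zero_one_tuples d n \<and> tuple_dep d n C. real (extensions C))
      = card {C \<in> zero_one_tuples d n. tuple_dep d n C} * 2 ^ d"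
    by (simp add: extensions_iff card_zero_one_vecs)
  also have "(\<Sum>C\<in>indep_tuples d n. real (extensions C))
      = (\<Sum>C\<in>indep_tuples d n. real (card (zero_one_vecs d \<inter> tuple_span d n C)))"
    by (intro sum.cong refl) (simp add: extensions_iff indep_tuples_def Int_def)
  finally show ?thesis
    by (simp add: tuple_prob_def add_divide_distrib power_add)
qed

definition dep_prob :: "nat \<Rightarrow> real" where
  "dep_prob d = tuple_prob d (d - 1) (tuple_dep d (d - 1))"

lemma P_s_decomposition:
  assumes "d \<ge> 1"
  shows "P_s d = dep_prob d + (1 - dep_prob d) * (1 / 2 ^ d * expected_spanned d)"
proof -
  define n where "n = d - 1"
  have d: "d = Suc n" and n: "d - 1 = n" using assms by (simp_all add: n_def)
  have "P_s d = dep_prob d + card (indep_tuples d n) * expected_spanned d / 2 ^ (d * d)"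
    using tuple_prob_tuple_dep_Suc[of d n] sum_card_tuple_span[of d]
    unfolding P_s_eq_tuple_prob dep_prob_def n d[symmetric] by simp
  also have "(2 :: real) ^ (d * d) = 2 ^ (d * n) * 2 ^ d"
    by (simp add: d flip: power_add)
  also have "card (indep_tuples d n) * expected_spanned d / (2 ^ (d * n) * 2 ^ d)
      = tuple_prob d n (\<lambda>C. \<not> tuple_dep d n C) * (1 / 2 ^ d * expected_spanned d)"
    by (simp add: tuple_prob_def indep_tuples_def)
  finally show ?thesis by (simp only: tuple_prob_not dep_prob_def n)
qed

section \<open>Linear relations with large support\<close>

definition short_dep :: "nat \<Rightarrow> nat \<Rightarrow> nat \<Rightarrow> (nat \<Rightarrow> real vec) \<Rightarrow> bool" where
  "short_dep d n K C \<longleftrightarrow> (\<exists>\<alpha>\<in>relations d n C. support n \<alpha> \<noteq> {} \<and> card (support n \<alpha>) \<le> K)"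

definition long_dep :: "nat \<Rightarrow> nat \<Rightarrow> nat \<Rightarrow> (nat \<Rightarrow> real vec) \<Rightarrow> bool" where
  "long_dep d n K C \<longleftrightarrow> tuple_dep d n C \<and> \<not> short_dep d n K C"

definition coloops :: "nat \<Rightarrow> nat \<Rightarrow> (nat \<Rightarrow> real vec) \<Rightarrow> nat set" where
  "coloops d n C = {j. j < n \<and> (\<forall>\<alpha>\<in>relations d n C. \<alpha> j = 0)}"

definition coloop_tuples :: "nat \<Rightarrow> nat \<Rightarrow> nat \<Rightarrow> nat \<Rightarrow> (nat \<Rightarrow> real vec) set" where
  "coloop_tuples d n K i = {C \<in> zero_one_tuples d n. long_dep d n K C \<and> i \<in> coloops d n C}"

lemma relations_permute:
  assumes p: "p permutes {..<n}"
  shows "relations d n (C \<circ> p) = (\<lambda>\<alpha>. \<alpha> \<circ> p) ` relations d n C"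
proof -
  have comp: "\<alpha> \<circ> p \<in> relations d n (C \<circ> p) \<longleftrightarrow> \<alpha> \<in> relations d n C" for \<alpha>
    using sum.permute[OF p, of "\<lambda>j. C j $ i * \<alpha> j" for i] by (simp add: relations_iff comp_def)
  have inverse: "\<alpha> = \<alpha> \<circ> inv_into UNIV p \<circ> p" for \<alpha> :: "nat \<Rightarrow> real"
    using permutes_inv_o(2)[OF p] by (simp add: comp_assoc)
  show ?thesis
  proof (intro equalityI subsetI)
    fix \<alpha> assume "\<alpha> \<in> relations d n (C \<circ> p)"
    then have "\<alpha> \<circ> inv_into UNIV p \<in> relations d n C"
      using comp[of "\<alpha> \<circ> inv_into UNIV p"] by (simp flip: inverse)
    then show "\<alpha> \<in> (\<lambda>\<alpha>. \<alpha> \<circ> p) ` relations d n C"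
      by (rule image_eqI[rotated]) (rule inverse)
  qed (auto simp: comp)
qed

lemma support_permute:
  assumes p: "p permutes {..<n}"
  shows "support n (\<alpha> \<circ> p) = p -` support n \<alpha>"
  using permutes_in_image[OF p] by (auto simp: support_def)

lemma coloops_permute:
  assumes p: "p permutes {..<n}"
  shows "coloops d n (C \<circ> p) = p -` coloops d n C"
  using permutes_in_image[OF p] by (auto simp: coloops_def relations_permute[OF p])

lemma long_dep_permute:
  assumes p: "p permutes {..<n}"
  shows "long_dep d n K (C \<circ> p) \<longleftrightarrow> long_dep d n K C"
proof -
  have "card (support n (\<alpha> \<circ> p)) = card (support n \<alpha>)" for \<alpha>
    unfolding support_permute[OF p]
    using permutes_inj[OF p] permutes_surj[OF p] by (intro card_vimage_inj) auto
  moreover from this have "support n (\<alpha> \<circ> p) = {} \<longleftrightarrow> support n \<alpha> = {}" for \<alpha>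
    by (metis card_0_eq finite_support)
  ultimately show ?thesis
    by (simp add: long_dep_def tuple_dep_def short_dep_def relations_permute[OF p])
qed

lemma card_coloop_tuples_eq:
  assumes "i < n" "l < n"
  shows "card (coloop_tuples d n K i) = card (coloop_tuples d n K l)"
proof -
  define p where "p = Transposition.transpose i l"
  have p: "p permutes {..<n}" unfolding p_def using assms by (intro permutes_swap_id) auto
  have involutive: "C \<circ> p \<circ> p = C" for C :: "nat \<Rightarrow> real vec"
    by (simp add: p_def comp_assoc)
  have tuples: "C \<circ> p \<in> zero_one_tuples d n" if "C \<in> zero_one_tuples d n" for C
    using that permutes_in_image[OF p] permutes_not_in[OF p]
    by (auto simp: zero_one_tuples_def PiE_iff extensional_def)
  have "p i = l" "p l = i" by (simp_all add: p_def)
  then have "bij_betw (\<lambda>C. C \<circ> p) (coloop_tuples d n K i) (coloop_tuples d n K l)"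
    using involutive tuples unfolding coloop_tuples_def
    by (intro bij_betwI[where g = "\<lambda>C. C \<circ> p"])
      (auto simp: long_dep_permute[OF p] coloops_permute[OF p])
  then show ?thesis by (rule bij_betw_same_card)
qed

lemma card_coloops_le:
  assumes "long_dep d n K C"
  shows "card (coloops d n C) \<le> n - K"
proof -
  obtain \<alpha> where \<alpha>: "\<alpha> \<in> relations d n C" "support n \<alpha> \<noteq> {}"
    using assms by (auto simp: long_dep_def tuple_dep_def)
  then have "K < card (support n \<alpha>)"
    using assms by (auto simp: long_dep_def short_dep_def not_le)
  moreover have "card (coloops d n C) \<le> card ({..<n} - support n \<alpha>)"
    using \<alpha>(1) by (intro card_mono) (auto simp: coloops_def support_def)
  ultimately show ?thesis
    using support_subset[of n \<alpha>] by (simp add: card_Diff_subset)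
qed

lemma card_coloop_tuples_le:
  assumes "i < n"
  shows "n * card (coloop_tuples d n K i)
    \<le> (n - K) * card {C \<in> zero_one_tuples d n. long_dep d n K C}"
proof -
  define D where "D = {C \<in> zero_one_tuples d n. long_dep d n K C}"
  have "n * card (coloop_tuples d n K i) = (\<Sum>l<n. card (coloop_tuples d n K i))" by simp
  also have "\<dots> = (\<Sum>l<n. card (coloop_tuples d n K l))"
    by (intro sum.cong refl card_coloop_tuples_eq assms) simp
  also have "\<dots> = (\<Sum>l<n. card {C \<in> D. l \<in> coloops d n C})"
    by (simp add: coloop_tuples_def D_def)
  also have "\<dots> = (\<Sum>C\<in>D. card (coloops d n C))"
    by (rule sum_multicount_gen) (auto simp: D_def coloops_def intro!: arg_cong[where f = card])
  also have "\<dots> \<le> (\<Sum>C\<in>D. n - K)"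
    by (intro sum_mono card_coloops_le) (simp add: D_def)
  finally show ?thesis by (simp add: D_def mult.commute)
qed

lemma long_dep_Suc:
  assumes "long_dep d n K C" "v \<in> carrier_vec d" "v \<notin> tuple_span d n C"
  shows "long_dep d (Suc n) K (C(n := v))" "n \<in> coloops d (Suc n) (C(n := v))"
proof -
  have zero: "\<alpha> n = 0" if "\<alpha> \<in> relations d (Suc n) (C(n := v))" for \<alpha>
    using relation_imp_in_tuple_span[OF assms(2) that] assms(3) by blast
  then show "n \<in> coloops d (Suc n) (C(n := v))" by (simp add: coloops_def)
  have "short_dep d n K C" if "short_dep d (Suc n) K (C(n := v))"
    using that zero unfolding short_dep_def by (metis relations_Suc_zero support_Suc_eq)
  then have "\<not> short_dep d (Suc n) K (C(n := v))"
    using assms(1) by (auto simp: long_dep_def)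
  moreover have "tuple_dep d (Suc n) (C(n := v))"
    using assms(1,2) by (simp add: tuple_dep_Suc_iff long_dep_def)
  ultimately show "long_dep d (Suc n) K (C(n := v))" by (simp add: long_dep_def)
qed

lemma card_long_dep_le:
  assumes "n < d"
  shows "2 ^ d * card {C \<in> zero_one_tuples d n. long_dep d n K C}
    \<le> 2 * card (coloop_tuples d (Suc n) K n)"
proof -
  define D where "D = {C \<in> zero_one_tuples d n. long_dep d n K C}"
  define ext where "ext C = {v \<in> zero_one_vecs d. long_dep d (Suc n) K (C(n := v))
    \<and> n \<in> coloops d (Suc n) (C(n := v))}" for C
  have half: "2 ^ d \<le> 2 * card (ext C)" if "C \<in> D" for C
  proof -
    have "2 ^ d \<le> 2 * card (zero_one_vecs d - tuple_span d n C)"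
      using card_zero_one_vecs_tuple_span_le[OF assms, of C] that
      by (simp add: D_def card_Diff_subset_Int card_zero_one_vecs)
    also have "card (zero_one_vecs d - tuple_span d n C) \<le> card (ext C)"
      using that by (intro card_mono) (auto simp: D_def ext_def long_dep_Suc zero_one_vecs_carrier)
    finally show ?thesis by simp
  qed
  have "2 ^ d * card D = (\<Sum>C\<in>D. 2 ^ d)" by simp
  also have "\<dots> \<le> (\<Sum>C\<in>D. 2 * card (ext C))" by (intro sum_mono half)
  also have "\<dots> \<le> (\<Sum>C\<in>zero_one_tuples d n. 2 * card (ext C))"
    by (intro sum_mono2) (auto simp: D_def)
  also have "\<dots> = 2 * card (coloop_tuples d (Suc n) K n)"
    by (simp add: coloop_tuples_def card_zero_one_tuples_Suc ext_def sum_distrib_left)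
  finally show ?thesis by (simp add: D_def)
qed

lemma tuple_prob_long_dep_le:
  assumes "n < d"
  shows "real (Suc n) * tuple_prob d n (long_dep d n K)
    \<le> 2 * real (Suc n - K) * tuple_prob d (Suc n) (tuple_dep d (Suc n))"
proof -
  have "Suc n * (2 ^ d * card {C \<in> zero_one_tuples d n. long_dep d n K C})
      \<le> Suc n * (2 * card (coloop_tuples d (Suc n) K n))"
    by (intro mult_left_mono card_long_dep_le[OF assms]) simp
  also have "\<dots> \<le> 2 * (Suc n - K) * card {C \<in> zero_one_tuples d (Suc n). long_dep d (Suc n) K C}"
    using card_coloop_tuples_le[of n "Suc n" d K] by simp
  finally have "real (Suc n * (2 ^ d * card {C \<in> zero_one_tuples d n. long_dep d n K C}))
      \<le> real (2 * (Suc n - K) * card {C \<in> zero_one_tuples d (Suc n). long_dep d (Suc n) K C})"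
    by (rule of_nat_mono)
  then have "real (Suc n) * tuple_prob d n (long_dep d n K)
      \<le> 2 * real (Suc n - K) * tuple_prob d (Suc n) (long_dep d (Suc n) K)"
    by (simp add: tuple_prob_def field_simps power_add del: mult_Suc of_nat_Suc of_nat_diff)
  also have "\<dots> \<le> 2 * real (Suc n - K) * tuple_prob d (Suc n) (tuple_dep d (Suc n))"
    by (intro mult_left_mono tuple_prob_mono) (auto simp: long_dep_def)
  finally show ?thesis .
qed

section \<open>Linear relations with small support\<close>

definition degenerate :: "nat \<Rightarrow> nat \<Rightarrow> (nat \<Rightarrow> real vec) \<Rightarrow> bool" where
  "degenerate d n C \<longleftrightarrow> (\<exists>j<n. C j = 0\<^sub>v d) \<or> \<not> inj_on C {..<n}"

definition dep_with_support :: "nat \<Rightarrow> nat set \<Rightarrow> (nat \<Rightarrow> real vec) \<Rightarrow> bool" where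
  "dep_with_support d J C \<longleftrightarrow> nowhere_zero_kernel {..<d} J (\<lambda>i j. C j $ i) \<noteq> {}"

lemma degenerate_imp_tuple_dep: "degenerate d n C \<Longrightarrow> tuple_dep d n C"
  using tuple_dep_if_zero tuple_dep_if_not_inj by (auto simp: degenerate_def)

lemma sum_support_relation:
  assumes "\<alpha> \<in> relations d n C" "i < d"
  shows "(\<Sum>j\<in>support n \<alpha>. C j $ i * \<alpha> j) = 0"
proof -
  have "(\<Sum>j\<in>support n \<alpha>. C j $ i * \<alpha> j) = (\<Sum>j<n. C j $ i * \<alpha> j)"
    by (intro sum.mono_neutral_left) (auto simp: support_def)
  then show ?thesis using assms by (simp add: relations_iff)
qed

lemma relation_imp_dep_with_support:
  assumes "\<alpha> \<in> relations d n C"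
  shows "dep_with_support d (support n \<alpha>) C"
proof -
  have "\<alpha> \<in> nowhere_zero_kernel {..<d} (support n \<alpha>) (\<lambda>i j. C j $ i)"
    using sum_support_relation[OF assms]
    by (simp add: nowhere_zero_kernel_def kernel_on_def) (simp add: support_def)
  then show ?thesis by (auto simp: dep_with_support_def)
qed

lemma degenerate_if_card_support_le_2:
  assumes C: "C \<in> zero_one_tuples d n" and \<alpha>: "\<alpha> \<in> relations d n C" "support n \<alpha> \<noteq> {}"
    and "card (support n \<alpha>) \<le> 2"
  shows "degenerate d n C"
proof -
  have in_support: "j < n" "\<alpha> j \<noteq> 0" if "j \<in> support n \<alpha>" for j
    using that by (simp_all add: support_def)
  have "0 < card (support n \<alpha>)" using \<alpha>(2) by (simp add: card_gt_0_iff)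
  then consider (singleton) "card (support n \<alpha>) = 1" | (pair) "card (support n \<alpha>) = 2"
    using assms(4) by linarith
  then show ?thesis
  proof cases
    case singleton
    then obtain j where j: "support n \<alpha> = {j}" by (auto simp: card_1_singleton_iff)
    have "C j = 0\<^sub>v d"
    proof (rule eq_vecI)
      show "C j $ i = 0\<^sub>v d $ i" if "i < dim_vec (0\<^sub>v d)" for i
        using sum_support_relation[OF \<alpha>(1), of i] in_support[of j] that by (simp add: j)
    qed (use zero_one_tuples_carrier[OF C] in_support j in auto)
    then show ?thesis using in_support j by (auto simp: degenerate_def)
  next
    case pair
    then obtain j l where jl: "support n \<alpha> = {j, l}" "j \<noteq> l" by (auto simp: card_2_iff)
    have less: "j < n" "l < n" using in_support jl by auto
    have "C j = C l"
    proof (rule eq_vecI)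
      fix i assume "i < dim_vec (C l)"
      then have "i < d" using zero_one_tuples_carrier[OF C less(2)] by simp
      then have "C j $ i \<in> {0, 1}" "C l $ i \<in> {0, 1}"
        using C less by (auto simp: zero_one_tuples_def PiE_iff zero_one_vecs_def)
      moreover have "C j $ i * \<alpha> j + C l $ i * \<alpha> l = 0"
        using sum_support_relation[OF \<alpha>(1) \<open>i < d\<close>] jl by simp
      ultimately show "C j $ i = C l $ i" using in_support[of j] in_support[of l] jl by auto
    qed (use zero_one_tuples_carrier[OF C less(1)] zero_one_tuples_carrier[OF C less(2)] in simp)
    then show ?thesis using less jl(2) by (auto simp: degenerate_def inj_on_def)
  qed
qed

lemma tuple_prob_dep_with_support_le:
  assumes "J \<subseteq> {..<n}" "J \<noteq> {}" "card J - 1 \<le> d"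
  shows "tuple_prob d n (dep_with_support d J)
    \<le> real (d choose (card J - 1)) * lo_bound (card J) 1 ^ (d - (card J - 1))"
proof -
  define S where "S = {C \<in> zero_one_tuples d n. dep_with_support d J C}"
  define T where "T = {M \<in> {..<d} \<rightarrow>\<^sub>E ({..<n} \<rightarrow>\<^sub>E {0, 1 :: real}).
    nowhere_zero_kernel {..<d} J M \<noteq> {}}"
  define rows where "rows C = (\<lambda>i\<in>{..<d}. \<lambda>j\<in>{..<n}. C j $ i)" for C :: "nat \<Rightarrow> real vec"
  have "card S \<le> card T"
  proof (rule card_inj_on_le[of rows])
    show "inj_on rows S"
    proof (rule inj_onI)
      fix C C' assume "C \<in> S" "C' \<in> S" and rows_eq: "rows C = rows C'"
      then have C: "C \<in> zero_one_tuples d n" "C' \<in> zero_one_tuples d n" by (auto simp: S_def)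
      have "C j $ i = C' j $ i" if "i < d" "j < n" for i j
        using fun_cong[OF fun_cong[OF rows_eq, of i], of j] that by (simp add: rows_def)
      then have "C j = C' j" if "j < n" for j
        using that C[THEN zero_one_tuples_carrier, OF that] by (intro eq_vecI) auto
      then show "C = C'" using C unfolding zero_one_tuples_def by (intro PiE_ext[of C _ _ C']) auto
    qed
    have "nowhere_zero_kernel {..<d} J (rows C) \<noteq> {}" if "dep_with_support d J C" for C
      using that assms(1)
      by (auto simp: dep_with_support_def nowhere_zero_kernel_def kernel_on_def rows_def subset_iff)
    moreover have "rows C \<in> {..<d} \<rightarrow>\<^sub>E ({..<n} \<rightarrow>\<^sub>E {0, 1})" if "C \<in> zero_one_tuples d n" for C
      using that unfolding rows_def
      by (intro restrict_PiE_iff[THEN iffD2] ballI)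
        (auto simp: zero_one_tuples_def PiE_iff zero_one_vecs_def)
    ultimately show "rows ` S \<subseteq> T" unfolding S_def T_def by (intro image_subsetI) simp
    show "finite T" by (simp add: T_def finite_PiE)
  qed
  then have "real (card S) \<le> real (card T)" by simp
  also have "\<dots> \<le> real (card {..<d} choose (card J - 1))
      * lo_bound (card J) 1 ^ (card {..<d} - (card J - 1)) * 2 ^ (card {..<n} * card {..<d})"
    unfolding T_def using assms by (intro card_nowhere_zero_kernel_le) auto
  finally show ?thesis
    by (simp add: tuple_prob_def S_def[symmetric] divide_le_eq mult.commute)
qed

lemma sum_subsets_card:
  fixes f :: "nat \<Rightarrow> 'a::comm_semiring_1"
  assumes "finite A" "finite K"
  shows "(\<Sum>J | J \<subseteq> A \<and> card J \<in> K. f (card J)) = (\<Sum>k\<in>K. of_nat (card A choose k) * f k)"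
proof -
  define \<J> where "\<J> = {J. J \<subseteq> A \<and> card J \<in> K}"
  have "(\<Sum>J\<in>\<J>. f (card J)) = (\<Sum>k\<in>K. \<Sum>J | J \<in> \<J> \<and> card J = k. f (card J))"
    by (rule sum.group[symmetric]) (use assms in \<open>auto simp: \<J>_def\<close>)
  also have "\<dots> = (\<Sum>k\<in>K. of_nat (card A choose k) * f k)"
  proof (rule sum.cong)
    fix k assume "k \<in> K"
    then have "{J \<in> \<J>. card J = k} = {J. J \<subseteq> A \<and> card J = k}" by (auto simp: \<J>_def)
    then have "card {J \<in> \<J>. card J = k} = card A choose k" using assms(1) by (simp add: n_subsets)
    then show "(\<Sum>J | J \<in> \<J> \<and> card J = k. f (card J)) = of_nat (card A choose k) * f k"
      by simp
  qed simp
  finally show ?thesis by (simp add: \<J>_def)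
qed

definition support_bound :: "nat \<Rightarrow> nat \<Rightarrow> nat \<Rightarrow> real" where
  "support_bound d n k = real (n choose k) * real (d choose (k - 1)) * lo_bound k 1 ^ (d - (k - 1))"

lemma tuple_prob_short_dep_le:
  assumes "K \<le> d"
  shows "tuple_prob d n (\<lambda>C. short_dep d n K C \<and> \<not> degenerate d n C)
    \<le> (\<Sum>k=3..K. support_bound d n k)"
proof -
  define \<J> where "\<J> = {J. J \<subseteq> {..<n} \<and> card J \<in> {3..K}}"
  define bound where "bound k = real (d choose (k - 1)) * lo_bound k 1 ^ (d - (k - 1))" for k
  have "finite \<J>" by (simp add: \<J>_def)
  have "\<exists>J\<in>\<J>. dep_with_support d J C"
    if C: "C \<in> zero_one_tuples d n" "short_dep d n K C \<and> \<not> degenerate d n C" for C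
  proof -
    obtain \<alpha> where \<alpha>: "\<alpha> \<in> relations d n C" "support n \<alpha> \<noteq> {}" "card (support n \<alpha>) \<le> K"
      using C(2) by (auto simp: short_dep_def)
    then have "\<not> card (support n \<alpha>) \<le> 2"
      using degenerate_if_card_support_le_2[OF C(1)] C(2) by blast
    then have "support n \<alpha> \<in> \<J>" using \<alpha>(3) support_subset by (auto simp: \<J>_def)
    then show ?thesis using relation_imp_dep_with_support[OF \<alpha>(1)] by blast
  qed
  then have "tuple_prob d n (\<lambda>C. short_dep d n K C \<and> \<not> degenerate d n C)
      \<le> tuple_prob d n (\<lambda>C. \<exists>J\<in>\<J>. dep_with_support d J C)"
    by (rule tuple_prob_mono)
  also have "\<dots> \<le> (\<Sum>J\<in>\<J>. tuple_prob d n (dep_with_support d J))"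
    by (rule tuple_prob_bex_le) fact
  also have "\<dots> \<le> (\<Sum>J\<in>\<J>. bound (card J))"
  proof (rule sum_mono)
    fix J assume "J \<in> \<J>"
    then have "J \<subseteq> {..<n}" "J \<noteq> {}" "card J - 1 \<le> d" using assms by (auto simp: \<J>_def)
    then show "tuple_prob d n (dep_with_support d J) \<le> bound (card J)"
      unfolding bound_def by (rule tuple_prob_dep_with_support_le)
  qed
  also have "\<dots> = (\<Sum>k=3..K. support_bound d n k)"
    using sum_subsets_card[of "{..<n}" "{3..K}" bound]
    by (simp add: \<J>_def support_bound_def bound_def mult.assoc)
  finally show ?thesis .
qed

section \<open>Asymptotics\<close>

lemma tuple_prob_not_degenerate:
  assumes "n \<le> 2 ^ d"
  shows "tuple_prob d n (\<lambda>C. \<not> degenerate d n C) = (\<Prod>j<n. 1 - (real j + 1) / 2 ^ d)"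
proof -
  have "0\<^sub>v d \<in> zero_one_vecs d" by (simp add: zero_one_vecs_def)
  then have nonzero_vecs: "card (zero_one_vecs d - {0\<^sub>v d}) = 2 ^ d - 1"
    by (simp add: card_zero_one_vecs)
  have "{C \<in> zero_one_tuples d n. \<not> degenerate d n C}
      = {C \<in> {..<n} \<rightarrow>\<^sub>E zero_one_vecs d - {0\<^sub>v d}. inj_on C {..<n}}"
    by (auto simp: zero_one_tuples_def degenerate_def PiE_iff)
  then have "card {C \<in> zero_one_tuples d n. \<not> degenerate d n C} = (\<Prod>j<n. 2 ^ d - 1 - j)"
    using card_inj_on_subset_funcset[of "{..<n}" "zero_one_vecs d - {0\<^sub>v d}" "{..<n}"]
    by (simp add: nonzero_vecs lessThan_atLeast0)
  then have "tuple_prob d n (\<lambda>C. \<not> degenerate d n C) = (\<Prod>j<n. real (2 ^ d - 1 - j)) / (\<Prod>j<n. 2 ^ d)"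
    by (simp add: tuple_prob_def power_mult)
  also have "\<dots> = (\<Prod>j<n. real (2 ^ d - 1 - j) / 2 ^ d)" by (rule prod_dividef[symmetric])
  also have "\<dots> = (\<Prod>j<n. 1 - (real j + 1) / 2 ^ d)"
  proof (intro prod.cong refl)
    fix j assume "j \<in> {..<n}"
    then have "j + 1 \<le> 2 ^ d" using assms by simp
    then have "real (2 ^ d - 1 - j) = 2 ^ d - (real j + 1)"
      using of_nat_diff[of "j + 1" "2 ^ d", where 'a = real] by (simp add: algebra_simps)
    then show "real (2 ^ d - 1 - j) / 2 ^ d = 1 - (real j + 1) / 2 ^ d"
      by (simp add: diff_divide_distrib)
  qed
  finally show ?thesis .
qed

lemma prod_one_minus_le:
  fixes f :: "'a \<Rightarrow> real"
  assumes "finite A" "\<And>j. j \<in> A \<Longrightarrow> f j \<in> {0..1}"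
  shows "(\<Prod>j\<in>A. 1 - f j) \<le> 1 / (1 + (\<Sum>j\<in>A. f j))"
proof -
  have "(\<Prod>j\<in>A. 1 - f j) \<le> (\<Prod>j\<in>A. exp (- f j))"
  proof (rule prod_mono)
    fix j assume "j \<in> A"
    then show "0 \<le> 1 - f j \<and> 1 - f j \<le> exp (- f j)"
      using assms(2)[of j] exp_ge_add_one_self[of "- f j"] by simp
  qed
  also have "\<dots> = exp (\<Sum>j\<in>A. - f j)" by (rule exp_sum[OF assms(1), symmetric])
  also have "\<dots> = 1 / exp (\<Sum>j\<in>A. f j)" by (simp add: sum_negf exp_minus inverse_eq_divide)
  also have "\<dots> \<le> 1 / (1 + (\<Sum>j\<in>A. f j))"
    using assms(2) by (intro divide_left_mono) (auto simp: sum_nonneg add_pos_nonneg)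
  finally show ?thesis .
qed

lemma tuple_prob_degenerate_bounds:
  assumes "n \<le> 2 ^ d"
  defines "s \<equiv> real n * (real n + 1) / 2 ^ (d + 1)"
  shows "tuple_prob d n (degenerate d n) \<le> s" and "s / (1 + s) \<le> tuple_prob d n (degenerate d n)"
proof -
  define f where "f j = (real j + 1) / 2 ^ d" for j :: nat
  have "(\<Sum>j<n. f j) = (\<Sum>j<n. real j + 1) / 2 ^ d"
    by (simp only: f_def sum_divide_distrib)
  also have "(\<Sum>j<n. real j + 1) = real n * (real n + 1) / 2"
    by (induction n) (auto simp: field_simps)
  finally have sum_f: "(\<Sum>j<n. f j) = s" by (simp add: s_def)
  have f: "f j \<in> {0..1}" if "j \<in> {..<n}" for j
  proof -
    have "real (j + 1) \<le> real (2 ^ d)" using that assms(1) by (simp only: of_nat_le_iff) simp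
    then show ?thesis by (simp add: f_def divide_le_eq)
  qed
  have prob_eq: "tuple_prob d n (degenerate d n) = 1 - (\<Prod>j<n. 1 - f j)"
    using tuple_prob_not[of d n "degenerate d n"] tuple_prob_not_degenerate[OF assms(1)]
    by (simp add: f_def)
  show "tuple_prob d n (degenerate d n) \<le> s"
    using Weierstrass_prod_ineq[of "{..<n}" f, OF f] sum_f unfolding prob_eq by linarith
  have "1 - 1 / (1 + s) \<le> tuple_prob d n (degenerate d n)"
    using prod_one_minus_le[of "{..<n}" f, OF _ f] sum_f by (simp add: prob_eq)
  moreover have "0 \<le> s" by (simp add: s_def)
  then have "1 - 1 / (1 + s) = s / (1 + s)" by (simp add: field_simps)
  ultimately show "s / (1 + s) \<le> tuple_prob d n (degenerate d n)" by simp
qed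

definition degenerate_prob :: "nat \<Rightarrow> real" where
  "degenerate_prob d = tuple_prob d (d - 1) (degenerate d (d - 1))"

lemma degenerate_prob_asymp_equiv: "degenerate_prob \<sim>[at_top] (\<lambda>d. real d ^ 2 / 2 ^ (d + 1))"
proof (rule asymp_equiv_sandwich_real)
  define s where "s d = real d * (real d - 1) / 2 ^ (d + 1)" for d
  show "(\<lambda>d. s d / (1 + s d)) \<sim>[at_top] (\<lambda>d. real d ^ 2 / 2 ^ (d + 1))"
    unfolding s_def by real_asymp
  show "s \<sim>[at_top] (\<lambda>d. real d ^ 2 / 2 ^ (d + 1))"
    unfolding s_def by real_asymp
  show "\<forall>\<^sub>F d in at_top. degenerate_prob d \<in> {s d / (1 + s d)..s d}"
    using eventually_ge_at_top[of 1]
  proof eventually_elim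
    case (elim d)
    have "d - 1 \<le> 2 ^ d" using less_exp[of d] by linarith
    then show ?case
      using tuple_prob_degenerate_bounds[of "d - 1" d] elim
      by (simp add: degenerate_prob_def s_def of_nat_diff mult.commute)
  qed
qed

lemma binomial_le_power_div:
  fixes t :: real
  assumes "0 < t"
  shows "real (n choose k) \<le> (1 + t) ^ n / t ^ k"
proof (cases "k \<le> n")
  case True
  have "real (n choose k) * t ^ k \<le> (\<Sum>i\<le>n. real (n choose i) * t ^ i * 1 ^ (n - i))"
    using True assms member_le_sum[of k "{..n}" "\<lambda>i. real (n choose i) * t ^ i * 1 ^ (n - i)"]
    by simp
  also have "\<dots> = (1 + t) ^ n" using binomial_ring[of t 1 n] by (simp add: add.commute)
  finally show ?thesis using assms by (simp add: pos_le_divide_eq)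
next
  case False
  then show ?thesis using assms by (simp add: binomial_eq_0)
qed

text \<open>The base of the power only matters in being below \<open>1 / 2\<close>; it is
  \<open>(21 / 20)\<^sup>2 * (3 / 8) * (6 / 5)\<close>.\<close>

lemma support_bound_le_few:
  assumes "n \<le> d" "3 \<le> k" "50 * k \<le> d"
  shows "support_bound d n k \<le> (3969 / 8000) ^ d"
proof -
  have binomial_bound: "real (d choose l) \<le> (21 / 20) ^ d * 20 ^ k" if "l \<le> k" for l
  proof -
    have "real (d choose l) \<le> (21 / 20) ^ d * 20 ^ l"
      using binomial_le_power_div[of "1 / 20" d l] by (simp add: power_divide)
    also have "\<dots> \<le> (21 / 20) ^ d * 20 ^ k"
      using that by (intro mult_left_mono power_increasing) auto
    finally show ?thesis .
  qed
  have "real (n choose k) \<le> real (d choose k)" using assms(1) by (simp add: binomial_right_mono)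
  then have columns: "real (n choose k) \<le> (21 / 20) ^ d * 20 ^ k" using binomial_bound[of k] by simp
  have "lo_bound 3 1 = 3 / 8" by (simp add: numeral_eq_Suc)
  then have "lo_bound k 1 ^ (d - (k - 1)) \<le> (3 / 8) ^ (d - (k - 1))"
    using lo_bound_antimono[OF assms(2), of 1] by (intro power_mono) (auto simp: lo_bound_nonneg)
  also have "\<dots> \<le> (3 / 8) ^ (d - k)" by (intro power_decreasing) auto
  also have "\<dots> = (3 / 8) ^ d * (8 / 3) ^ k"
    using assms(3) by (simp add: power_diff power_divide field_simps)
  finally have "support_bound d n k
      \<le> ((21 / 20) ^ d * 20 ^ k) * ((21 / 20) ^ d * 20 ^ k) * ((3 / 8) ^ d * (8 / 3) ^ k)"
    unfolding support_bound_def
    by (intro mult_mono columns binomial_bound) (auto simp: lo_bound_nonneg)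
  also have "\<dots> = (21 / 20 * (21 / 20) * (3 / 8)) ^ d * (20 * 20 * (8 / 3)) ^ k"
    by (simp only: power_mult_distrib mult_ac)
  also have "\<dots> \<le> (21 / 20 * (21 / 20) * (3 / 8)) ^ d * (6 / 5) ^ d"
  proof (intro mult_left_mono)
    have "(20 * 20 * (8 / 3)) ^ k \<le> ((6 / 5) ^ 50 :: real) ^ k"
      by (intro power_mono) (auto simp: power_divide)
    also have "\<dots> = (6 / 5) ^ (50 * k)" by (simp only: power_mult)
    also have "\<dots> \<le> (6 / 5) ^ d" using assms(3) by (intro power_increasing) auto
    finally show "(20 * 20 * (8 / 3)) ^ k \<le> (6 / 5 :: real) ^ d" .
  qed auto
  also have "\<dots> = (3969 / 8000) ^ d" by (simp flip: power_mult_distrib)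
  finally show ?thesis .
qed

lemma support_bound_le_many:
  assumes "n \<le> d" "lo_bound k 1 \<le> (1 / 12) ^ m" "1 \<le> k" "k \<le> d - d div m" "m > 0"
  shows "support_bound d n k \<le> (1 / 3) ^ d"
proof -
  have binomial_bound: "real (l choose i) \<le> 2 ^ d" if "l \<le> d" for l i
  proof -
    have "l choose i \<le> 2 ^ d"
      by (rule order_trans[OF binomial_le_pow2]) (use that in simp)
    then show ?thesis by (metis of_nat_le_iff of_nat_numeral of_nat_power)
  qed
  have "d div m \<le> d" by simp
  then have "m * (d div m + 1) \<le> m * (d - (k - 1))"
    using assms(3,4) by (intro mult_left_mono) auto
  moreover have "d < m * (d div m + 1)"
    using dividend_less_times_div[OF assms(5), of d] by (simp add: mult.commute)
  ultimately have exponent: "d \<le> m * (d - (k - 1))" by linarith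
  have "lo_bound k 1 ^ (d - (k - 1)) \<le> ((1 / 12) ^ m) ^ (d - (k - 1))"
    by (intro power_mono assms(2) lo_bound_nonneg)
  also have "\<dots> = (1 / 12) ^ (m * (d - (k - 1)))" by (simp only: power_mult)
  also have "\<dots> \<le> (1 / 12) ^ d" using exponent by (intro power_decreasing) auto
  finally have "support_bound d n k \<le> 2 ^ d * 2 ^ d * (1 / 12) ^ d"
    unfolding support_bound_def using assms(1)
    by (intro mult_mono binomial_bound) (auto simp: lo_bound_nonneg)
  also have "\<dots> = (1 / 3) ^ d" by (simp flip: power_mult_distrib)
  finally show ?thesis .
qed

lemma eventually_sum_support_bound_le:
  assumes "m > 0"
  shows "\<forall>\<^sub>F d in at_top. \<forall>n\<le>d.
    (\<Sum>k=3..d - d div m. support_bound d n k) \<le> real d * (3969 / 8000) ^ d"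
proof -
  have "\<forall>\<^sub>F k in sequentially. lo_bound k 1 < (1 / 12) ^ m"
    by (rule order_tendstoD(2)[OF lo_bound_tendsto_0]) simp
  then obtain k0 where k0: "\<And>k. k \<ge> k0 \<Longrightarrow> lo_bound k 1 \<le> (1 / 12) ^ m"
    by (auto simp: eventually_sequentially intro: less_imp_le)
  show ?thesis
    using eventually_ge_at_top[of "50 * k0"]
  proof eventually_elim
    case (elim d)
    have "support_bound d n k \<le> (3969 / 8000) ^ d" if "n \<le> d" and k: "k \<in> {3..d - d div m}" for n k
    proof (cases "50 * k \<le> d")
      case True
      then show ?thesis using k support_bound_le_few[OF \<open>n \<le> d\<close>] by simp
    next
      case False
      then have "support_bound d n k \<le> (1 / 3) ^ d"
        using k elim assms \<open>n \<le> d\<close> by (intro support_bound_le_many[of n d k m] k0) auto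
      also have "\<dots> \<le> (3969 / 8000) ^ d" by (intro power_mono) auto
      finally show ?thesis .
    qed
    then have "(\<Sum>k=3..d - d div m. support_bound d n k) \<le> (\<Sum>k=3..d - d div m. (3969 / 8000) ^ d)"
      if "n \<le> d" for n
      using that by (intro sum_mono) auto
    moreover have "(\<Sum>k=3..d - d div m. (3969 / 8000) ^ d) \<le> real d * (3969 / 8000 :: real) ^ d"
      by simp
    ultimately show ?case by (meson order_trans)
  qed
qed

lemma power_smallo_quadratic_half_power:
  fixes c :: real
  assumes "\<bar>c\<bar> < 1 / 2"
  shows "(\<lambda>d. real d * c ^ d) \<in> o(\<lambda>d. real d ^ 2 / 2 ^ (d + 1))"
proof (rule smalloI_tendsto)
  have "(\<lambda>d. 2 / real d * (2 * c) ^ d) \<longlonglongrightarrow> 0 * 0"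
    using assms by (intro tendsto_mult LIMSEQ_power_zero) (real_asymp, simp add: abs_mult)
  then have "(\<lambda>d. 2 / real d * (2 * c) ^ d) \<longlonglongrightarrow> 0" by simp
  moreover have "\<forall>\<^sub>F d in at_top.
      2 / real d * (2 * c) ^ d = real d * c ^ d / (real d ^ 2 / 2 ^ (d + 1))"
    using eventually_gt_at_top[of 0]
    by eventually_elim (simp add: power2_eq_square power_mult_distrib field_simps)
  ultimately show "(\<lambda>d. real d * c ^ d / (real d ^ 2 / 2 ^ (d + 1))) \<longlonglongrightarrow> 0"
    by (rule Lim_transform_eventually)
  show "\<forall>\<^sub>F d in at_top. real d ^ 2 / 2 ^ (d + 1) \<noteq> 0"
    using eventually_gt_at_top[of 0] by eventually_elim simp
qed

lemma dep_prob_bounds: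
  assumes "d \<ge> 1" "m > 0"
  shows "degenerate_prob d \<le> dep_prob d"
    and "dep_prob d \<le> degenerate_prob d
      + (\<Sum>k=3..d - d div m. support_bound d (d - 1) k) + 2 / real m * P_s d"
proof -
  define n K where "n = d - 1" and "K = d - d div m"
  have d: "d = Suc n" using assms(1) by (simp add: n_def)
  show "degenerate_prob d \<le> dep_prob d"
    unfolding degenerate_prob_def dep_prob_def by (intro tuple_prob_mono degenerate_imp_tuple_dep)
  have "dep_prob d
      \<le> tuple_prob d n (\<lambda>C. degenerate d n C
          \<or> short_dep d n K C \<and> \<not> degenerate d n C \<or> long_dep d n K C)"
    unfolding dep_prob_def n_def by (rule tuple_prob_mono) (auto simp: long_dep_def)
  also have "\<dots> \<le> degenerate_prob d
      + (tuple_prob d n (\<lambda>C. short_dep d n K C \<and> \<not> degenerate d n C)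
        + tuple_prob d n (long_dep d n K))"
    unfolding degenerate_prob_def n_def
    by (intro order_trans[OF tuple_prob_disj_le] add_left_mono tuple_prob_disj_le)
  also have "tuple_prob d n (\<lambda>C. short_dep d n K C \<and> \<not> degenerate d n C)
      \<le> (\<Sum>k=3..K. support_bound d n k)"
    by (rule tuple_prob_short_dep_le) (simp add: K_def)
  also have "tuple_prob d n (long_dep d n K) \<le> 2 / real m * P_s d"
  proof -
    have "real (d - K) \<le> real d / real m"
      using of_nat_div_le_of_nat[of d m, where 'a = real] by (simp add: K_def)
    then have "2 * real (d - K) * P_s d \<le> 2 * (real d / real m) * P_s d"
      by (intro mult_right_mono mult_left_mono) (simp_all add: P_s_nonneg)
    moreover have "real d * tuple_prob d n (long_dep d n K) \<le> 2 * real (d - K) * P_s d"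
      using tuple_prob_long_dep_le[of n d K] unfolding d[symmetric] P_s_eq_tuple_prob
      by (simp add: d)
    moreover have "2 * (real d / real m) * P_s d = real d * (2 / real m * P_s d)" by simp
    ultimately have "real d * tuple_prob d n (long_dep d n K) \<le> real d * (2 / real m * P_s d)"
      by linarith
    then show ?thesis by (rule mult_left_le_imp_le) (use assms(1) in simp)
  qed
  finally show "dep_prob d \<le> degenerate_prob d
      + (\<Sum>k=3..d - d div m. support_bound d (d - 1) k) + 2 / real m * P_s d"
    by (simp add: K_def n_def)
qed

lemma dep_prob_minus_degenerate_smallo:
  "(\<lambda>d. dep_prob d - degenerate_prob d) \<in> o(\<lambda>d. real d ^ 2 / 2 ^ (d + 1) + P_s d)"
proof (rule landau_o.smallI)
  fix c :: real assume "c > 0"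
  then obtain m :: nat where "2 / c < real m" using reals_Archimedean2 by blast
  moreover from this \<open>c > 0\<close> have "m > 0"
    by (metis divide_pos_pos of_nat_0_less_iff order.strict_trans zero_less_numeral)
  ultimately have m: "m > 0" "2 / real m \<le> c"
    using \<open>c > 0\<close> by (simp_all add: field_simps)
  have "\<forall>\<^sub>F d in at_top. norm (real d * (3969 / 8000) ^ d) \<le> c * norm (real d ^ 2 / 2 ^ (d + 1))"
    using power_smallo_quadratic_half_power[of "3969 / 8000"] \<open>c > 0\<close>
    by (intro landau_o.smallD) auto
  then show "\<forall>\<^sub>F d in at_top. norm (dep_prob d - degenerate_prob d)
      \<le> c * norm (real d ^ 2 / 2 ^ (d + 1) + P_s d)"
    using eventually_sum_support_bound_le[OF m(1)] eventually_ge_at_top[of 1]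
  proof eventually_elim
    case (elim d)
    have "2 / real m * P_s d \<le> c * P_s d" using m(2) P_s_nonneg by (rule mult_right_mono)
    moreover have "(\<Sum>k=3..d - d div m. support_bound d (d - 1) k) \<le> c * (real d ^ 2 / 2 ^ (d + 1))"
      using elim(1) elim(2)[rule_format, of "d - 1"] by simp
    ultimately show ?case
      using dep_prob_bounds[OF elim(3) m(1)] P_s_nonneg[of d] by (simp add: distrib_left)
  qed
qed

lemma asymp_equiv_if_perturbed_mixture:
  fixes P q e x :: "'a \<Rightarrow> real"
  assumes mixture: "\<forall>\<^sub>F n in F. P n = q n + (1 - q n) * e n"
    and nonneg: "\<And>n. 0 \<le> e n" "\<And>n. 0 \<le> x n" "\<And>n. 0 \<le> P n"
    and "P \<in> O[F](\<lambda>_. 1)" "x \<in> o[F](\<lambda>_. 1)" "(\<lambda>n. q n - x n) \<in> o[F](\<lambda>n. x n + P n)"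
  shows "P \<sim>[F] (\<lambda>n. e n + x n)"
proof -
  have "x \<in> O[F](\<lambda>_. 1)" using assms(6) by (rule landau_o.small_imp_big)
  then have "(\<lambda>n. x n + P n) \<in> O[F](\<lambda>_. 1)" using assms(5) by (rule sum_in_bigo(1))
  then have "(\<lambda>n. q n - x n) \<in> o[F](\<lambda>_. 1)" by (rule landau_o.small_big_trans[OF assms(7)])
  then have "(\<lambda>n. (q n - x n) + x n) \<in> o[F](\<lambda>_. 1)" using assms(6) by (rule sum_in_smallo)
  then have mixed: "(\<lambda>n. q n * e n) \<in> o[F](e)"
    using landau_o.small_big_mult[of q F "\<lambda>_. 1" e e] by simp
  define g where "g = (\<lambda>n. e n + x n)"
  define h where "h n = g n + P n" for n
  have "(\<lambda>n. x n + P n) \<in> O[F](h)"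
    using nonneg by (intro bigoI[of _ 1] always_eventually) (simp add: g_def h_def)
  with assms(7) have "(\<lambda>n. q n - x n) \<in> o[F](h)" by (rule landau_o.small_big_trans)
  moreover have "e \<in> O[F](h)"
    using nonneg by (intro bigoI[of _ 1] always_eventually) (simp add: g_def h_def)
  with mixed have "(\<lambda>n. q n * e n) \<in> o[F](h)" by (rule landau_o.small_big_trans)
  ultimately have "(\<lambda>n. (q n - x n) - q n * e n) \<in> o[F](h)"
    by (rule sum_in_smallo)
  moreover have "\<forall>\<^sub>F n in F. (q n - x n) - q n * e n = P n - g n"
    using mixture by eventually_elim (simp add: g_def algebra_simps)
  ultimately have difference: "(\<lambda>n. P n - g n) \<in> o[F](h)"
    by (subst (asm) landau_o.small.in_cong) auto
  then have "\<forall>\<^sub>F n in F. norm (P n - g n) \<le> 1 / 2 * norm (h n)"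
    by (rule landau_o.smallD) simp
  then have "\<forall>\<^sub>F n in F. norm (h n) \<le> 4 * norm (g n)"
  proof eventually_elim
    case (elim n)
    then show ?case using nonneg[of n] by (simp add: g_def h_def abs_if split: if_splits)
  qed
  then have "h \<in> O[F](g)" by (rule bigoI)
  with difference have "(\<lambda>n. P n - g n) \<in> o[F](g)" by (rule landau_o.small_big_trans)
  then show ?thesis by (simp add: asymp_equiv_altdef g_def)
qed

lemma dep_prob_minus_quadratic_smallo:
  "(\<lambda>d. dep_prob d - real d ^ 2 / 2 ^ (d + 1)) \<in> o(\<lambda>d. real d ^ 2 / 2 ^ (d + 1) + P_s d)"
proof -
  define x where "x d = real d ^ 2 / 2 ^ (d + 1)" for d :: nat
  have "(\<lambda>d. degenerate_prob d - x d) \<in> o(x)"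
    using degenerate_prob_asymp_equiv unfolding x_def asymp_equiv_altdef .
  moreover have "x \<in> O(\<lambda>d. x d + P_s d)"
    using P_s_nonneg by (intro bigoI[of _ 1] always_eventually) (simp add: x_def)
  ultimately have "(\<lambda>d. degenerate_prob d - x d) \<in> o(\<lambda>d. x d + P_s d)"
    by (rule landau_o.small_big_trans)
  moreover have "(\<lambda>d. dep_prob d - degenerate_prob d) \<in> o(\<lambda>d. x d + P_s d)"
    unfolding x_def by (rule dep_prob_minus_degenerate_smallo)
  ultimately have "(\<lambda>d. (degenerate_prob d - x d) + (dep_prob d - degenerate_prob d))
      \<in> o(\<lambda>d. x d + P_s d)"
    by (rule sum_in_smallo)
  then show ?thesis by (simp add: x_def)
qed

theorem theorem1:
  shows "(\<lambda>d. P_s d / (1 / 2 ^ d * expected_spanned d + real d ^ 2 / 2 ^ (d + 1))) \<longlonglongrightarrow> 1"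
proof (rule asymp_equivD_strong)
  have "\<forall>\<^sub>F d in at_top. P_s d = dep_prob d + (1 - dep_prob d) * (1 / 2 ^ d * expected_spanned d)"
    using eventually_ge_at_top[of 1] by eventually_elim (rule P_s_decomposition)
  moreover have "P_s \<in> O(\<lambda>_. 1)"
    using P_s_nonneg P_s_le_1 by (intro bigoI[of _ 1]) simp
  moreover have "(\<lambda>d. real d ^ 2 / 2 ^ (d + 1)) \<in> o(\<lambda>_. 1)" by real_asymp
  ultimately show "P_s \<sim>[at_top] (\<lambda>d. 1 / 2 ^ d * expected_spanned d + real d ^ 2 / 2 ^ (d + 1))"
    using dep_prob_minus_quadratic_smallo P_s_nonneg expected_spanned_nonneg
    by (intro asymp_equiv_if_perturbed_mixture) auto
  show "\<forall>\<^sub>F d in at_top. P_s d \<noteq> 0 \<or> 1 / 2 ^ d * expected_spanned d + real d ^ 2 / 2 ^ (d + 1) \<noteq> 0"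
    using eventually_gt_at_top[of 0]
    by eventually_elim
      (auto intro!: less_imp_neq[symmetric] add_nonneg_pos simp: expected_spanned_nonneg)
qed

end
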